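(* Let $(M,\omega)$ be a closed symplectic manifold equipped with a Hamiltonian action of a Lie group $G$ with Lie algebra $\mathfrak g$. Let $X,Y\in\mathfrak g$ be elements which define circle actions $\psi^X$ and $\psi^Y$ on $M$. If $X$ and $Y$ are of different type, then $\psi^X$ and $\psi^Y$ are not homotopic by means of a family of $U(1)$-actions; that is, there is no continuous family $\{\psi^s:U(1)\to\mathrm{Ham}(M)\}_{s\in[0,1]}$ of Lie group homomorphisms with $\psi^0=\psi^X$ and $\psi^1=\psi^Y$.
   Context: $\mathrm{Ham}(M)$ is the group of Hamiltonian diffeomorphisms of $(M,\omega)$ with its usual ($C^\infty$) topology. A Hamiltonian action of a Lie group $G$ is a Lie group homomorphism $G\to\mathrm{Ham}(M)$. If $X\in\mathfrak g$ defines a circle action $\psi^X$ on $M$ (i.e. the one-parameter group generated by $X$ through the $G$-action gives a $U(1)$-action), then $X$ is said to be of type $s$ when some connected component of the fixed point set of $\psi^X$ is a $2s$-dimensional submanifold of $M$ and no connected component of the fixed point set has greater dimension. *)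

theory Defs
  imports "HOL-Analysis.Analysis" "HOL-Algebra.Bij"
begin

section \<open>Smooth maps between open subsets of Euclidean spaces\<close>

text \<open>Iterated directional derivatives.  Only used at interior points of the set on which the
  function is meaningful, so that values of the function elsewhere play no role.\<close>

primrec iter_deriv ::
    "'a::euclidean_space list \<Rightarrow> ('a \<Rightarrow> 'b::real_normed_vector) \<Rightarrow> 'a \<Rightarrow> 'b" where
  "iter_deriv [] f = f"
| "iter_deriv (v # vs) f = iter_deriv vs (\<lambda>x. frechet_derivative f (at x) v)"

text \<open>\<open>C\<^sup>\<infinity>\<close> on an open set \<open>S\<close>: the function and all its iterated partial derivatives are
  (totally) differentiable, hence also continuous, at every point of \<open>S\<close>.\<close>

definition smooth_on :: "'a::euclidean_space set \<Rightarrow> ('a \<Rightarrow> 'b::real_normed_vector) \<Rightarrow> bool" where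
  "smooth_on S f \<longleftrightarrow> open S \<and>
     (\<forall>vs \<in> lists Basis. \<forall>x \<in> S. iter_deriv vs f differentiable (at x))"


section \<open>Smooth manifolds\<close>

text \<open>A chart is a pair of its domain and its coordinate map.\<close>

type_synonym ('a, 'e) chart = "'a set \<times> ('a \<Rightarrow> 'e)"

abbreviation chart_dom :: "('a, 'e) chart \<Rightarrow> 'a set" where
  "chart_dom c \<equiv> fst c"

abbreviation coord :: "('a, 'e) chart \<Rightarrow> 'a \<Rightarrow> 'e" where
  "coord c \<equiv> snd c"

definition coord_inv :: "('a, 'e) chart \<Rightarrow> 'e \<Rightarrow> 'a" where
  "coord_inv c = inv_into (chart_dom c) (coord c)"

definition coord_img :: "('a, 'e) chart \<Rightarrow> 'e set" where
  "coord_img c = coord c ` chart_dom c"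

text \<open>The coordinate representation of a map.\<close>

definition coord_rep :: "('a, 'e) chart \<Rightarrow> ('b, 'f) chart \<Rightarrow> ('a \<Rightarrow> 'b) \<Rightarrow> 'e \<Rightarrow> 'f" where
  "coord_rep c c' f = coord c' \<circ> f \<circ> coord_inv c"

abbreviation transition :: "('a, 'e) chart \<Rightarrow> ('a, 'e) chart \<Rightarrow> 'e \<Rightarrow> 'e" where
  "transition c c' \<equiv> coord_rep c c' (\<lambda>p. p)"

definition is_chart :: "'a topology \<Rightarrow> ('a, 'e::euclidean_space) chart \<Rightarrow> bool" where
  "is_chart T c \<longleftrightarrow> openin T (chart_dom c) \<and> open (coord_img c) \<and>
     homeomorphic_map (subtopology T (chart_dom c)) (top_of_set (coord_img c)) (coord c)"

definition compatible :: "('a, 'e::euclidean_space) chart \<Rightarrow> ('a, 'e) chart \<Rightarrow> bool" where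
  "compatible c c' \<longleftrightarrow>
     smooth_on (coord c ` (chart_dom c \<inter> chart_dom c')) (transition c c') \<and>
     smooth_on (coord c' ` (chart_dom c \<inter> chart_dom c')) (transition c' c)"

text \<open>The underlying set of a manifold is the carrier of its topology.  The atlas need not be
  maximal; its dimension is that of the Euclidean space \<open>'e\<close>.\<close>

record ('a, 'e) manifold =
  mtop :: "'a topology"
  atlas :: "('a, 'e) chart set"

abbreviation points :: "('a, 'e) manifold \<Rightarrow> 'a set" where
  "points M \<equiv> topspace (mtop M)"

definition smooth_manifold :: "('a, 'e::euclidean_space) manifold \<Rightarrow> bool" where
  "smooth_manifold M \<longleftrightarrow> Hausdorff_space (mtop M) \<and> second_countable (mtop M) \<and>
     (\<forall>c \<in> atlas M. is_chart (mtop M) c) \<and>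
     (\<Union>c \<in> atlas M. chart_dom c) = points M \<and>
     (\<forall>c \<in> atlas M. \<forall>c' \<in> atlas M. compatible c c')"

definition smooth_map ::
    "('a, 'e::euclidean_space) manifold \<Rightarrow> ('b, 'f::euclidean_space) manifold \<Rightarrow> ('a \<Rightarrow> 'b) \<Rightarrow> bool"
  where
  "smooth_map M N f \<longleftrightarrow> continuous_map (mtop M) (mtop N) f \<and>
     (\<forall>c \<in> atlas M. \<forall>c' \<in> atlas N.
        smooth_on (coord c ` (chart_dom c \<inter> f -` chart_dom c')) (coord_rep c c' f))"

definition diffeomorphism :: "('a, 'e::euclidean_space) manifold \<Rightarrow> ('a \<Rightarrow> 'a) \<Rightarrow> bool" where
  "diffeomorphism M f \<longleftrightarrow> bij_betw f (points M) (points M) \<and>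
     smooth_map M M f \<and> smooth_map M M (inv_into (points M) f)"

definition prod_manifold ::
    "('a, 'e) manifold \<Rightarrow> ('b, 'f) manifold \<Rightarrow> ('a \<times> 'b, 'e \<times> 'f) manifold" where
  "prod_manifold M N =
     \<lparr>mtop = prod_topology (mtop M) (mtop N),
      atlas = {(chart_dom c \<times> chart_dom d, map_prod (coord c) (coord d)) |c d.
                 c \<in> atlas M \<and> d \<in> atlas N}\<rparr>"

definition real_line :: "(real, real) manifold" where
  "real_line = \<lparr>mtop = euclidean, atlas = {(UNIV, \<lambda>x. x)}\<rparr>"

text \<open>Embedded submanifolds of dimension \<open>d\<close>, by slice charts taken from the maximal atlas.\<close>

definition submanifold :: "('a, 'e::euclidean_space) manifold \<Rightarrow> nat \<Rightarrow> 'a set \<Rightarrow> bool" where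
  "submanifold M d S \<longleftrightarrow> S \<subseteq> points M \<and>
     (\<forall>p \<in> S. \<exists>c. is_chart (mtop M) c \<and> (\<forall>c' \<in> atlas M. compatible c c') \<and> p \<in> chart_dom c \<and>
        (\<exists>V. subspace V \<and> dim V = d \<and> coord c ` (chart_dom c \<inter> S) = coord_img c \<inter> V))"

text \<open>A tangent vector at \<open>p\<close> is the family of its components in all charts of the atlas around
  \<open>p\<close>, related by the chain rule (and normalised to \<open>0\<close> at all other arguments).\<close>

definition tangent_space ::
    "('a, 'e::euclidean_space) manifold \<Rightarrow> 'a \<Rightarrow> (('a, 'e) chart \<Rightarrow> 'e) set" where
  "tangent_space M p =
     {X. (\<forall>c \<in> atlas M. \<forall>c' \<in> atlas M. p \<in> chart_dom c \<longrightarrow> p \<in> chart_dom c' \<longrightarrow>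
            X c' = frechet_derivative (transition c c') (at (coord c p)) (X c)) \<and>
         (\<forall>c. c \<notin> atlas M \<or> p \<notin> chart_dom c \<longrightarrow> X c = 0)}"


section \<open>Symplectic forms\<close>

text \<open>A differential 2-form is given by its components: \<open>\<omega> c x u v\<close> is the value at the point
  with coordinates \<open>x\<close> in the chart \<open>c\<close> on the vectors with components \<open>u\<close> and \<open>v\<close>.\<close>

type_synonym ('a, 'e) form2 = "('a, 'e) chart \<Rightarrow> 'e \<Rightarrow> 'e \<Rightarrow> 'e \<Rightarrow> real"

definition smooth_form2 ::
    "('a, 'e::euclidean_space) manifold \<Rightarrow> ('a, 'e) form2 \<Rightarrow> bool" where
  "smooth_form2 M \<omega> \<longleftrightarrow>
     (\<forall>c \<in> atlas M. \<forall>x \<in> coord_img c. bilinear (\<omega> c x) \<and> (\<forall>u. \<omega> c x u u = 0)) \<and>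
     (\<forall>c \<in> atlas M. \<forall>u v. smooth_on (coord_img c) (\<lambda>x. \<omega> c x u v)) \<and>
     (\<forall>c \<in> atlas M. \<forall>c' \<in> atlas M. \<forall>p \<in> chart_dom c \<inter> chart_dom c'. \<forall>u v.
        \<omega> c (coord c p) u v =
        \<omega> c' (coord c' p) (frechet_derivative (transition c c') (at (coord c p)) u)
                         (frechet_derivative (transition c c') (at (coord c p)) v))"

text \<open>The sum below is \<open>d\<omega>(u, v, w)\<close> for constant coordinate vector fields \<open>u\<close>, \<open>v\<close>, \<open>w\<close>.\<close>

definition closed_form2 ::
    "('a, 'e::euclidean_space) manifold \<Rightarrow> ('a, 'e) form2 \<Rightarrow> bool" where
  "closed_form2 M \<omega> \<longleftrightarrow> (\<forall>c \<in> atlas M. \<forall>x \<in> coord_img c. \<forall>u v w.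
     frechet_derivative (\<lambda>y. \<omega> c y v w) (at x) u +
     frechet_derivative (\<lambda>y. \<omega> c y w u) (at x) v +
     frechet_derivative (\<lambda>y. \<omega> c y u v) (at x) w = 0)"

definition nondegenerate_form2 ::
    "('a, 'e::euclidean_space) manifold \<Rightarrow> ('a, 'e) form2 \<Rightarrow> bool" where
  "nondegenerate_form2 M \<omega> \<longleftrightarrow>
     (\<forall>c \<in> atlas M. \<forall>x \<in> coord_img c. \<forall>u. (\<forall>v. \<omega> c x u v = 0) \<longrightarrow> u = 0)"

definition closed_symplectic_manifold ::
    "('a, 'e::euclidean_space) manifold \<Rightarrow> ('a, 'e) form2 \<Rightarrow> bool" where
  "closed_symplectic_manifold M \<omega> \<longleftrightarrow> smooth_manifold M \<and> compact_space (mtop M) \<and>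
     smooth_form2 M \<omega> \<and> closed_form2 M \<omega> \<and> nondegenerate_form2 M \<omega>"


section \<open>The group of Hamiltonian diffeomorphisms\<close>

text \<open>\<open>\<psi>\<close> is the isotopy generated by the time-dependent Hamiltonian \<open>H\<close>: at all times
  \<open>\<omega>(d\<psi>\<^sub>t/dt, v) = dH\<^sub>t(v)\<close>, evaluated in charts at the point \<open>\<psi>\<^sub>t(p)\<close>.\<close>

definition hamiltonian_isotopy ::
    "('a, 'e::euclidean_space) manifold \<Rightarrow> ('a, 'e) form2 \<Rightarrow>
     (real \<Rightarrow> 'a \<Rightarrow> real) \<Rightarrow> (real \<Rightarrow> 'a \<Rightarrow> 'a) \<Rightarrow> bool" where
  "hamiltonian_isotopy M \<omega> H \<psi> \<longleftrightarrow>
     smooth_map (prod_manifold real_line M) real_line (\<lambda>(t, p). H t p) \<and>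
     smooth_map (prod_manifold real_line M) M (\<lambda>(t, p). \<psi> t p) \<and>
     (\<forall>t. diffeomorphism M (\<psi> t)) \<and>
     (\<forall>p \<in> points M. \<psi> 0 p = p) \<and>
     (\<forall>t. \<forall>p \<in> points M. \<forall>c \<in> atlas M. \<psi> t p \<in> chart_dom c \<longrightarrow> (\<forall>v.
        \<omega> c (coord c (\<psi> t p)) (vector_derivative (\<lambda>r. coord c (\<psi> r p)) (at t)) v =
        frechet_derivative (H t \<circ> coord_inv c) (at (coord c (\<psi> t p))) v))"

text \<open>Diffeomorphisms are represented as in \<^const>\<open>Bij\<close>: by functions that are
  \<^const>\<open>undefined\<close> off the manifold.\<close>

definition Ham :: "('a, 'e::euclidean_space) manifold \<Rightarrow> ('a, 'e) form2 \<Rightarrow> ('a \<Rightarrow> 'a) set" where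
  "Ham M \<omega> = {restrict (\<psi> 1) (points M) |H \<psi>. hamiltonian_isotopy M \<omega> H \<psi>}"

definition Ham_group ::
    "('a, 'e::euclidean_space) manifold \<Rightarrow> ('a, 'e) form2 \<Rightarrow> ('a \<Rightarrow> 'a) monoid" where
  "Ham_group M \<omega> = (BijGroup (points M))\<lparr>carrier := Ham M \<omega>\<rparr>"

text \<open>Basic neighbourhoods of \<open>f\<close> for the (weak Whitney) \<open>C\<^sup>\<infinity>\<close> topology: the maps that are
  uniformly close to \<open>f\<close> on \<open>K\<close>, in the charts \<open>c\<close> and \<open>c'\<close>, with all derivatives up to order
  \<open>k\<close>.\<close>

definition Cinf_nbhd ::
    "('a, 'e::euclidean_space) manifold \<Rightarrow> ('a \<Rightarrow> 'a) \<Rightarrow> ('a, 'e) chart \<Rightarrow> ('a, 'e) chart \<Rightarrow>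
     'a set \<Rightarrow> nat \<Rightarrow> real \<Rightarrow> ('a \<Rightarrow> 'a) set" where
  "Cinf_nbhd M f c c' K k \<epsilon> =
     {g \<in> extensional (points M). smooth_map M M g \<and> g ` K \<subseteq> chart_dom c' \<and>
        (\<forall>x \<in> coord c ` K. \<forall>vs \<in> lists Basis. length vs \<le> k \<longrightarrow>
           norm (iter_deriv vs (coord_rep c c' g) x - iter_deriv vs (coord_rep c c' f) x) < \<epsilon>)}"

definition Cinf_topology :: "('a, 'e::euclidean_space) manifold \<Rightarrow> ('a \<Rightarrow> 'a) topology" where
  "Cinf_topology M = topology_generated_by
     {Cinf_nbhd M f c c' K k \<epsilon> |f c c' K k \<epsilon>.
        f \<in> extensional (points M) \<and> smooth_map M M f \<and> c \<in> atlas M \<and> c' \<in> atlas M \<and>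
        compactin (mtop M) K \<and> K \<subseteq> chart_dom c \<and> f ` K \<subseteq> chart_dom c' \<and> 0 < \<epsilon>}"

definition Ham_topology ::
    "('a, 'e::euclidean_space) manifold \<Rightarrow> ('a, 'e) form2 \<Rightarrow> ('a \<Rightarrow> 'a) topology" where
  "Ham_topology M \<omega> = subtopology (Cinf_topology M) (Ham M \<omega>)"


section \<open>Lie groups and their Hamiltonian actions\<close>

definition lie_group :: "'g monoid \<Rightarrow> ('g, 'h::euclidean_space) manifold \<Rightarrow> bool" where
  "lie_group G \<G> \<longleftrightarrow> Group.group G \<and> smooth_manifold \<G> \<and> points \<G> = carrier G \<and>
     smooth_map (prod_manifold \<G> \<G>) \<G> (\<lambda>(g, h). g \<otimes>\<^bsub>G\<^esub> h) \<and>
     smooth_map \<G> \<G> (\<lambda>g. inv\<^bsub>G\<^esub> g)"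

text \<open>The Lie algebra as the tangent space at the identity; its bracket is not needed here.\<close>

definition lie_algebra ::
    "'g monoid \<Rightarrow> ('g, 'h::euclidean_space) manifold \<Rightarrow> (('g, 'h) chart \<Rightarrow> 'h) set" where
  "lie_algebra G \<G> = tangent_space \<G> \<one>\<^bsub>G\<^esub>"

text \<open>\<open>\<gamma> t = exp (t X)\<close>.\<close>

definition one_param_subgroup ::
    "'g monoid \<Rightarrow> ('g, 'h::euclidean_space) manifold \<Rightarrow> (('g, 'h) chart \<Rightarrow> 'h) \<Rightarrow>
     (real \<Rightarrow> 'g) \<Rightarrow> bool" where
  "one_param_subgroup G \<G> X \<gamma> \<longleftrightarrow> smooth_map real_line \<G> \<gamma> \<and>
     (\<forall>s t. \<gamma> (s + t) = \<gamma> s \<otimes>\<^bsub>G\<^esub> \<gamma> t) \<and>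
     (\<forall>c \<in> atlas \<G>. \<one>\<^bsub>G\<^esub> \<in> chart_dom c \<longrightarrow>
        ((coord c \<circ> \<gamma>) has_vector_derivative X c) (at 0))"

text \<open>A Lie group homomorphism into the infinite-dimensional group of Hamiltonian
  diffeomorphisms: smoothness means smoothness of the associated map \<open>G \<times> M \<rightarrow> M\<close>.\<close>

definition hamiltonian_action ::
    "'g monoid \<Rightarrow> ('g, 'h::euclidean_space) manifold \<Rightarrow>
     ('a, 'e::euclidean_space) manifold \<Rightarrow> ('a, 'e) form2 \<Rightarrow> ('g \<Rightarrow> 'a \<Rightarrow> 'a) \<Rightarrow> bool" where
  "hamiltonian_action G \<G> M \<omega> \<Phi> \<longleftrightarrow> \<Phi> \<in> hom G (Ham_group M \<omega>) \<and>
     smooth_map (prod_manifold \<G> M) M (\<lambda>(g, p). \<Phi> g p)"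


section \<open>Circle actions\<close>

definition circle_group :: "complex monoid" where
  "circle_group = \<lparr>carrier = sphere 0 1, mult = (*), one = 1\<rparr>"

text \<open>The charts are the branches of the argument on the circle minus a point.\<close>

definition circle_manifold :: "(complex, real) manifold" where
  "circle_manifold =
     \<lparr>mtop = top_of_set (sphere 0 1),
      atlas = range (\<lambda>a. (cis ` {a<..<a + 2 * pi}, inv_into {a<..<a + 2 * pi} cis))\<rparr>"

abbreviation circle_action ::
    "('a, 'e::euclidean_space) manifold \<Rightarrow> ('a, 'e) form2 \<Rightarrow> (complex \<Rightarrow> 'a \<Rightarrow> 'a) \<Rightarrow> bool" where
  "circle_action \<equiv> hamiltonian_action circle_group circle_manifold"

text \<open>The one-parameter group \<open>t \<mapsto> \<Phi> (exp (t X))\<close> has period 1 and descends to the action \<open>\<psi>\<close>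
  of \<open>U(1) = \<real>/\<int>\<close>.\<close>

definition defines_circle_action ::
    "'g monoid \<Rightarrow> ('g, 'h::euclidean_space) manifold \<Rightarrow>
     ('a, 'e::euclidean_space) manifold \<Rightarrow> ('a, 'e) form2 \<Rightarrow> ('g \<Rightarrow> 'a \<Rightarrow> 'a) \<Rightarrow>
     (('g, 'h) chart \<Rightarrow> 'h) \<Rightarrow> (complex \<Rightarrow> 'a \<Rightarrow> 'a) \<Rightarrow> bool" where
  "defines_circle_action G \<G> M \<omega> \<Phi> X \<psi> \<longleftrightarrow> circle_action M \<omega> \<psi> \<and>
     (\<exists>\<gamma>. one_param_subgroup G \<G> X \<gamma> \<and> (\<forall>t. \<psi> (cis (2 * pi * t)) = \<Phi> (\<gamma> t)))"

definition fixed_points :: "('a, 'e) manifold \<Rightarrow> (complex \<Rightarrow> 'a \<Rightarrow> 'a) \<Rightarrow> 'a set" where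
  "fixed_points M \<psi> = {p \<in> points M. \<forall>z \<in> carrier circle_group. \<psi> z p = p}"

definition fixed_components :: "('a, 'e) manifold \<Rightarrow> (complex \<Rightarrow> 'a \<Rightarrow> 'a) \<Rightarrow> 'a set set" where
  "fixed_components M \<psi> = connected_components_of (subtopology (mtop M) (fixed_points M \<psi>))"

definition of_type ::
    "('a, 'e::euclidean_space) manifold \<Rightarrow> (complex \<Rightarrow> 'a \<Rightarrow> 'a) \<Rightarrow> nat \<Rightarrow> bool" where
  "of_type M \<psi> s \<longleftrightarrow>
     (\<exists>C \<in> fixed_components M \<psi>. submanifold M (2 * s) C) \<and>
     (\<forall>C \<in> fixed_components M \<psi>. \<forall>d. submanifold M d C \<longrightarrow> d \<le> 2 * s)"

definition homotopic_circle_actions ::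
    "('a, 'e::euclidean_space) manifold \<Rightarrow> ('a, 'e) form2 \<Rightarrow>
     (complex \<Rightarrow> 'a \<Rightarrow> 'a) \<Rightarrow> (complex \<Rightarrow> 'a \<Rightarrow> 'a) \<Rightarrow> bool" where
  "homotopic_circle_actions M \<omega> \<psi>\<^sub>0 \<psi>\<^sub>1 \<longleftrightarrow> (\<exists>\<Psi> :: real \<Rightarrow> complex \<Rightarrow> 'a \<Rightarrow> 'a.
     (\<forall>s \<in> {0..1}. circle_action M \<omega> (\<Psi> s)) \<and>
     continuous_map (prod_topology (top_of_set {0..1}) (mtop circle_manifold)) (Ham_topology M \<omega>)
       (\<lambda>(s, z). \<Psi> s z) \<and>
     (\<forall>z \<in> carrier circle_group. \<Psi> 0 z = \<psi>\<^sub>0 z \<and> \<Psi> 1 z = \<psi>\<^sub>1 z))"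

end

theory Submission
  imports Defs
begin

text \<open>
  The largest dimension of a component of the fixed point set cannot change along a homotopy of
  circle actions, because circle actions are rigid: near a fixed point, an action close to a given
  one is conjugate to the same linear action.

  Let \<open>p\<close> be a fixed point of the action \<open>f\<close> at time \<open>s\<^sub>0\<close> of the homotopy, \<open>L t\<close> the derivative of
  \<open>f t\<close> at \<open>p\<close> in a chart, and \<open>g\<close> the action at a nearby time.  The average
  \<open>F x = \<integral>\<^sub>0\<^sup>1 L (- t) (g t x) dt\<close> intertwines \<open>g\<close> with \<open>L\<close>, \<open>F (g w x) = L w (F x)\<close>, and it is
  close to the identity in the \<open>C\<^sup>1\<close> sense on a neighbourhood of \<open>p\<close> that does not depend on \<open>g\<close>.
  Hence \<open>F\<close> is a smooth coordinate change there, and \<open>x\<close> is fixed by \<open>g\<close> exactly when \<open>F x\<close> lies in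
  the subspace \<open>V\<close> of vectors fixed by all \<open>L t\<close>.  Three things follow
  (\<open>fixed_neighbourhood\<close>): the fixed point set of \<open>g\<close> meets the neighbourhood, it is a smooth
  submanifold there, and its dimension is \<open>dim V\<close>, the same for all \<open>g\<close>.

  Let \<open>flat_times d\<close> be the set of the times at which some fixed point has local dimension \<open>d\<close>.  It is
  open by the above, and it is closed by the above and compactness of the manifold; so it is
  empty or the whole unit interval (\<open>flat_times_trivial\<close>).  The type of an action is half the
  largest \<open>d\<close> that occurs, so it is the same at both ends of the homotopy.

  The neighbourhoods are uniform because a homotopy that is continuous in the \<open>C\<^sup>\<infinity>\<close> topology
  has coordinate derivatives of all orders that are jointly continuous in time, group element and
  point (\<open>rep_jointly_continuous\<close>).
\<close>

section \<open>Closure properties of smooth functions\<close>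

text \<open>Smoothness in finitely many steps.  The rules for composition and for solving linear equations
  express the derivatives of a function by the function itself, so they are proved by induction on
  the number of derivatives.\<close>

primrec diff_upto ::
    "nat \<Rightarrow> 'a::euclidean_space set \<Rightarrow> ('a \<Rightarrow> 'b::real_normed_vector) \<Rightarrow> bool" where
  "diff_upto 0 S f \<longleftrightarrow> (\<forall>x \<in> S. f differentiable (at x))"
| "diff_upto (Suc n) S f \<longleftrightarrow> (\<forall>x \<in> S. f differentiable (at x)) \<and>
     (\<forall>b \<in> Basis. diff_upto n S (\<lambda>x. frechet_derivative f (at x) b))"

lemma diff_upto_iff:
  "diff_upto n S f \<longleftrightarrow>
     (\<forall>vs \<in> lists Basis. length vs \<le> n \<longrightarrow> (\<forall>x \<in> S. iter_deriv vs f differentiable (at x)))"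
proof (induction n arbitrary: f)
  case 0
  then show ?case by auto
next
  case (Suc n)
  show ?case
  proof
    assume L: "diff_upto (Suc n) S f"
    show "\<forall>vs \<in> lists Basis. length vs \<le> Suc n \<longrightarrow>
        (\<forall>x \<in> S. iter_deriv vs f differentiable (at x))"
    proof (intro ballI impI)
      fix vs :: "'a list" and x assume "vs \<in> lists Basis" "length vs \<le> Suc n" "x \<in> S"
      then show "iter_deriv vs f differentiable (at x)"
        using L Suc.IH by (cases vs) auto
    qed
  next
    assume R: "\<forall>vs \<in> lists Basis. length vs \<le> Suc n \<longrightarrow>
        (\<forall>x \<in> S. iter_deriv vs f differentiable (at x))"
    have "\<forall>x \<in> S. f differentiable (at x)"
      using R[rule_format, of "[]"] by auto
    moreover have "diff_upto n S (\<lambda>x. frechet_derivative f (at x) b)" if "b \<in> Basis" for b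
      unfolding Suc.IH using R[rule_format, of "b # _"] that by auto
    ultimately show "diff_upto (Suc n) S f" by simp
  qed
qed

lemma smooth_on_iff_diff_upto: "smooth_on S f \<longleftrightarrow> open S \<and> (\<forall>n. diff_upto n S f)"
  unfolding smooth_on_def diff_upto_iff by blast

lemma diff_upto_imp_differentiable: "diff_upto n S f \<Longrightarrow> x \<in> S \<Longrightarrow> f differentiable (at x)"
  by (cases n) auto

lemma diff_upto_imp_has_derivative:
  "diff_upto n S f \<Longrightarrow> x \<in> S \<Longrightarrow> (f has_derivative frechet_derivative f (at x)) (at x)"
  using diff_upto_imp_differentiable frechet_derivative_works by blast

lemma diff_upto_Suc_imp: "diff_upto (Suc n) S f \<Longrightarrow> diff_upto n S f"
  by (simp add: diff_upto_iff)

lemma diff_upto_cong: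
  assumes "open S" "\<And>x. x \<in> S \<Longrightarrow> f x = g x" "diff_upto n S f"
  shows "diff_upto n S g"
  using assms(2,3)
proof (induction n arbitrary: f g)
  case (0 f g)
  show ?case
    unfolding diff_upto.simps
  proof
    fix x assume "x \<in> S"
    with 0 obtain f' where "(f has_derivative f') (at x)" by (auto simp: differentiable_def)
    from has_derivative_transform_within_open[OF this \<open>open S\<close> \<open>x \<in> S\<close>] 0
    show "g differentiable (at x)" by (auto simp: differentiable_def)
  qed
next
  case (Suc n f g)
  have "\<forall>x \<in> S. g differentiable (at x)"
  proof
    fix x assume "x \<in> S"
    with Suc obtain f' where "(f has_derivative f') (at x)" by (auto simp: differentiable_def)
    from has_derivative_transform_within_open[OF this \<open>open S\<close> \<open>x \<in> S\<close>] Suc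
    show "g differentiable (at x)" by (auto simp: differentiable_def)
  qed
  moreover have "diff_upto n S (\<lambda>x. frechet_derivative g (at x) b)" if "b \<in> Basis" for b
  proof (rule Suc.IH)
    show "diff_upto n S (\<lambda>x. frechet_derivative f (at x) b)" using Suc.prems that by simp
    fix x assume "x \<in> S"
    then show "frechet_derivative f (at x) b = frechet_derivative g (at x) b"
      using frechet_derivative_transform_within_open[of f x S g] Suc.prems \<open>open S\<close> by simp
  qed
  ultimately show ?case by simp
qed

text \<open>Derivatives come as explicit formulas; this rule avoids computing with
  \<^const>\<open>frechet_derivative\<close>.\<close>

lemma diff_upto_SucI:
  assumes "open S" "\<And>x. x \<in> S \<Longrightarrow> (f has_derivative f' x) (at x)"
    and "\<And>b. b \<in> Basis \<Longrightarrow> diff_upto n S (\<lambda>x. f' x b)"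
  shows "diff_upto (Suc n) S f"
proof -
  have "diff_upto n S (\<lambda>x. frechet_derivative f (at x) b)" if "b \<in> Basis" for b
    by (rule diff_upto_cong[OF \<open>open S\<close> _ assms(3)[OF that]])
      (simp flip: frechet_derivative_at[OF assms(2)])
  then show ?thesis
    using assms(2) by (auto simp: differentiable_def)
qed

lemma diff_upto_0I:
  "(\<And>x. x \<in> S \<Longrightarrow> (f has_derivative f' x) (at x)) \<Longrightarrow> diff_upto 0 S f"
  by (auto simp: differentiable_def)

lemma diff_upto_const: "open S \<Longrightarrow> diff_upto n S (\<lambda>x. c)"
proof (induction n arbitrary: c)
  case (Suc n)
  show ?case by (rule diff_upto_SucI[where f' = "\<lambda>_ _. 0"]) (use Suc in auto)
qed simp

lemma diff_upto_add:
  assumes "open S" "diff_upto n S f" "diff_upto n S g"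
  shows "diff_upto n S (\<lambda>x. f x + g x)"
  using assms(2,3)
proof (induction n arbitrary: f g)
  case (Suc n)
  show ?case
    by (rule diff_upto_SucI[OF \<open>open S\<close> has_derivative_add[OF
              diff_upto_imp_has_derivative[OF Suc.prems(1)] diff_upto_imp_has_derivative[OF Suc.prems(2)]]])
       (use Suc in auto)
qed auto

lemma diff_upto_scaleR:
  fixes a :: "'a::euclidean_space \<Rightarrow> real"
  assumes "open S" "diff_upto n S a" "diff_upto n S f"
  shows "diff_upto n S (\<lambda>x. a x *\<^sub>R f x)"
  using assms(2,3)
proof (induction n arbitrary: a f)
  case (Suc n)
  show ?case
  proof (rule diff_upto_SucI[OF \<open>open S\<close> has_derivative_scaleR[OF
              diff_upto_imp_has_derivative[OF Suc.prems(1)] diff_upto_imp_has_derivative[OF Suc.prems(2)]]])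
    fix b :: 'a assume "b \<in> Basis"
    then show "diff_upto n S (\<lambda>x. a x *\<^sub>R frechet_derivative f (at x) b +
          frechet_derivative a (at x) b *\<^sub>R f x)"
      using Suc.prems Suc.prems[THEN diff_upto_Suc_imp]
      by (intro diff_upto_add Suc.IH \<open>open S\<close>) auto
  qed
qed auto

lemma diff_upto_bounded_linear:
  assumes "open S" "bounded_linear h" "diff_upto n S f"
  shows "diff_upto n S (\<lambda>x. h (f x))"
  using assms(3)
proof (induction n arbitrary: f)
  case 0
  show ?case
    by (rule diff_upto_0I[OF bounded_linear.has_derivative[OF assms(2)
          diff_upto_imp_has_derivative[OF 0]]])
next
  case (Suc n)
  show ?case
    by (rule diff_upto_SucI[OF \<open>open S\<close> bounded_linear.has_derivative[OF assms(2)
          diff_upto_imp_has_derivative[OF Suc.prems]]])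
       (use Suc in auto)
qed

lemma diff_upto_sum:
  assumes "open S" "finite I" "\<And>i. i \<in> I \<Longrightarrow> diff_upto n S (f i)"
  shows "diff_upto n S (\<lambda>x. \<Sum>i\<in>I. f i x)"
  using assms(2,3)
  by (induction I rule: finite_induct) (auto intro: diff_upto_const diff_upto_add assms(1))

lemma diff_upto_diff:
  assumes "open S" "diff_upto n S f" "diff_upto n S g"
  shows "diff_upto n S (\<lambda>x. f x - g x)"
  using diff_upto_add[OF assms(1,2) diff_upto_bounded_linear[OF assms(1) _ assms(3),
      of uminus]] by (simp add: bounded_linear_minus[OF bounded_linear_ident])

lemma linear_basis_expansion:
  fixes h :: "'a::euclidean_space \<Rightarrow> 'b::real_vector"
  assumes "linear h"
  shows "h v = (\<Sum>b\<in>Basis. (v \<bullet> b) *\<^sub>R h b)"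
  by (metis (no_types, lifting) euclidean_representation assms linear_sum linear_scale sum.cong)

text \<open>The partial derivatives of \<open>g \<circ> f\<close> are sums of products of partial derivatives of \<open>f\<close> with
  functions \<open>\<partial>\<^sub>b g \<circ> f\<close>, to which the induction hypothesis applies.\<close>

lemma diff_upto_compose:
  fixes f :: "'a::euclidean_space \<Rightarrow> 'b::euclidean_space" and g :: "'b \<Rightarrow> 'c::real_normed_vector"
  assumes "open S" "diff_upto n S f" "diff_upto n T g" "f ` S \<subseteq> T"
  shows "diff_upto n S (\<lambda>x. g (f x))"
  using assms(2,3)
proof (induction n arbitrary: g)
  case (0 g)
  show ?case
    by (rule diff_upto_0I[OF has_derivative_compose[OF diff_upto_imp_has_derivative[OF 0(1)]
              diff_upto_imp_has_derivative[OF 0(2)]]]) (use assms(4) in auto)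
next
  case (Suc n g)
  have T: "f x \<in> T" if "x \<in> S" for x using assms(4) that by auto
  have der: "((\<lambda>x. g (f x)) has_derivative
      (\<lambda>v. \<Sum>b\<in>Basis. (frechet_derivative f (at x) v \<bullet> b) *\<^sub>R frechet_derivative g (at (f x)) b)) (at x)"
    if "x \<in> S" for x
  proof -
    note g' = diff_upto_imp_has_derivative[OF Suc.prems(2) T[OF that]]
    have "(\<lambda>v. \<Sum>b\<in>Basis. (frechet_derivative f (at x) v \<bullet> b) *\<^sub>R frechet_derivative g (at (f x)) b) =
        (\<lambda>v. frechet_derivative g (at (f x)) (frechet_derivative f (at x) v))"
      by (rule ext) (rule linear_basis_expansion[OF has_derivative_linear[OF g'], symmetric])
    then show ?thesis
      using has_derivative_compose[OF diff_upto_imp_has_derivative[OF Suc.prems(1) that] g'] by simp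
  qed
  show ?case
  proof (rule diff_upto_SucI[OF \<open>open S\<close> der])
    fix v :: 'a assume v: "v \<in> Basis"
    show "diff_upto n S (\<lambda>x. \<Sum>b\<in>Basis. (frechet_derivative f (at x) v \<bullet> b) *\<^sub>R
            frechet_derivative g (at (f x)) b)"
      using Suc.prems Suc.prems[THEN diff_upto_Suc_imp] v
      by (intro diff_upto_sum diff_upto_scaleR diff_upto_bounded_linear[OF _ bounded_linear_inner_left]
          Suc.IH \<open>open S\<close>) auto
  qed
qed

lemma smooth_on_open: "smooth_on S f \<Longrightarrow> open S"
  by (simp add: smooth_on_def)

lemma smooth_on_cong:
  assumes "smooth_on S f" "\<And>x. x \<in> S \<Longrightarrow> f x = g x"
  shows "smooth_on S g"
  using assms diff_upto_cong[of S f g] unfolding smooth_on_iff_diff_upto by blast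

lemma smooth_on_subset: "smooth_on S f \<Longrightarrow> open T \<Longrightarrow> T \<subseteq> S \<Longrightarrow> smooth_on T f"
  unfolding smooth_on_def by blast

lemma smooth_on_compose:
  assumes "smooth_on S f" "smooth_on T g" "f ` S \<subseteq> T"
  shows "smooth_on S (\<lambda>x. g (f x))"
  using assms diff_upto_compose unfolding smooth_on_iff_diff_upto by blast

text \<open>The product rule at a common zero of the factors: one of them need only be continuous.\<close>

lemma has_derivative_vanishing_product:
  fixes c :: "'a::real_normed_vector \<Rightarrow> real" and k :: "'a \<Rightarrow> 'b::real_normed_vector"
  assumes k: "(k has_derivative k') (at x)" and c: "isCont c x" and zero: "k x = 0" "c x = 0"
  shows "((\<lambda>y. c y *\<^sub>R k y) has_derivative (\<lambda>_. 0)) (at x)"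
proof -
  obtain B where B: "B > 0" "\<And>v. norm (k' v) \<le> norm v * B"
    using bounded_linear.pos_bounded[OF has_derivative_bounded_linear[OF k]] by blast
  have lim: "((\<lambda>y. norm (k y - k' (y - x)) / norm (y - x)) \<longlongrightarrow> 0) (at x)"
    using k by (simp add: has_derivative_iff_norm zero)
  have "((\<lambda>y. \<bar>c y\<bar> * (norm (k y - k' (y - x)) / norm (y - x) + B)) \<longlongrightarrow> 0 * (0 + B)) (at x)"
    by (intro tendsto_intros lim) (use c zero in \<open>simp add: isCont_def tendsto_rabs_zero\<close>)
  then have lim': "((\<lambda>y. \<bar>c y\<bar> * (norm (k y - k' (y - x)) / norm (y - x) + B)) \<longlongrightarrow> 0) (at x)"
    by simp
  have "((\<lambda>y. norm (c y *\<^sub>R k y) / norm (y - x)) \<longlongrightarrow> 0) (at x)"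
  proof (rule tendsto_sandwich[OF _ _ tendsto_const lim'])
    show "\<forall>\<^sub>F y in at x. norm (c y *\<^sub>R k y) / norm (y - x)
        \<le> \<bar>c y\<bar> * (norm (k y - k' (y - x)) / norm (y - x) + B)"
    proof (rule eventually_at_topological[THEN iffD2], intro exI[of _ UNIV] conjI ballI impI)
      fix y assume "y \<noteq> x"
      have "norm (k y) \<le> norm (k y - k' (y - x)) + norm (k' (y - x))"
        by (metis diff_add_cancel norm_triangle_ineq)
      also have "\<dots> \<le> norm (k y - k' (y - x)) + norm (y - x) * B" using B by simp
      finally have "norm (k y) / norm (y - x) \<le> norm (k y - k' (y - x)) / norm (y - x) + B"
        using \<open>y \<noteq> x\<close> by (simp add: field_simps)
      then show "norm (c y *\<^sub>R k y) / norm (y - x)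
          \<le> \<bar>c y\<bar> * (norm (k y - k' (y - x)) / norm (y - x) + B)"
        using mult_left_mono[of _ _ "\<bar>c y\<bar>"] by fastforce
    qed auto
  qed auto
  then show ?thesis by (simp add: has_derivative_iff_norm zero)
qed

text \<open>The solution \<open>h\<close> of a linear system inherits differentiability from its data.  Here
  \<open>A y (h y - h x) = r y\<close> with \<open>r\<close> differentiable and \<open>r x = 0\<close>; up to a product of two factors
  vanishing at \<open>x\<close> this determines \<open>h y - h x\<close> as the image of \<open>r y\<close> under the inverse of \<open>A x\<close>.\<close>

lemma differentiable_linear_solve:
  fixes A :: "'a::euclidean_space \<Rightarrow> 'b::euclidean_space \<Rightarrow> 'b"
  assumes "open S" "x \<in> S"
    and lin: "\<And>y. y \<in> S \<Longrightarrow> linear (A y)"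
    and bound: "\<And>y h. y \<in> S \<Longrightarrow> norm h \<le> C * norm (A y h)"
    and A: "\<And>b. b \<in> Basis \<Longrightarrow> (\<lambda>y. A y b) differentiable (at x)"
    and u: "u differentiable (at x)"
    and sol: "\<And>y. y \<in> S \<Longrightarrow> A y (h y) = u y"
  shows "h differentiable (at x)"
proof -
  have A_exp: "A y v = (\<Sum>b\<in>Basis. (v \<bullet> b) *\<^sub>R A y b)" if "y \<in> S" for y v
    using linear_basis_expansion[OF lin[OF that]] .
  define r where "r = (\<lambda>y. u y - (\<Sum>b\<in>Basis. (h x \<bullet> b) *\<^sub>R A y b))"
  have r: "r differentiable (at x)"
    unfolding r_def
    by (intro differentiable_diff u differentiable_sum ballI finite_Basis
        differentiable_scaleR differentiable_const A)
  have r_eq: "A y (h y - h x) = r y" if "y \<in> S" for y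
    using that sol[OF that] A_exp[OF that, of "h x"] by (simp add: r_def linear_diff[OF lin])
  have r0: "r x = 0"
    using r_eq[OF \<open>x \<in> S\<close>] linear_0[OF lin[OF \<open>x \<in> S\<close>]] by simp
  \<comment> \<open>Continuity of the solution comes first, from the uniform bound on the inverses.\<close>
  have cont: "isCont h x"
  proof -
    have "r \<midarrow>x\<rightarrow> 0"
      using differentiable_imp_continuous_within[OF r] r0 by (simp add: continuous_within)
    then have "(\<lambda>y. C * norm (r y)) \<midarrow>x\<rightarrow> 0"
      by (intro tendsto_mult_right_zero tendsto_norm_zero)
    moreover have "\<forall>\<^sub>F y in at x. norm (h y - h x) \<le> C * norm (r y)"
      using eventually_at_in_open'[OF assms(1,2)] by eventually_elim (metis bound r_eq)
    ultimately have "(\<lambda>y. h y - h x) \<midarrow>x\<rightarrow> 0"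
      by (rule Lim_null_comparison[rotated])
    then show ?thesis by (simp add: isCont_def LIM_zero_iff)
  qed
  have inj: "inj (A x)"
  proof -
    have "v = 0" if "A x v = 0" for v using bound[OF \<open>x \<in> S\<close>, of v] that by simp
    then show ?thesis using linear_injective_0[OF lin[OF \<open>x \<in> S\<close>]] by auto
  qed
  obtain B where B: "linear B" "B \<circ> A x = id"
    using linear_injective_left_inverse[OF lin[OF \<open>x \<in> S\<close>] inj] by blast
  have BA: "B (A x v) = v" for v using B(2) by (simp add: fun_eq_iff)
  have bl: "bounded_linear B" using B(1) linear_conv_bounded_linear by blast
  define q where "q = (\<lambda>y. B (r y) - B (\<Sum>b\<in>Basis. ((h y - h x) \<bullet> b) *\<^sub>R (A y b - A x b)))"
  have q: "h y = h x + q y" if "y \<in> S" for y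
  proof -
    have "(\<Sum>b\<in>Basis. ((h y - h x) \<bullet> b) *\<^sub>R (A y b - A x b)) = A y (h y - h x) - A x (h y - h x)"
      unfolding A_exp[OF that, of "h y - h x"] A_exp[OF \<open>x \<in> S\<close>, of "h y - h x"]
      by (simp add: sum_subtractf scaleR_diff_right)
    then have "q y = B (A x (h y - h x))"
      using r_eq[OF that] by (simp add: q_def linear_diff[OF B(1)])
    then show ?thesis by (simp add: BA)
  qed
  have "(\<lambda>y. \<Sum>b\<in>Basis. ((h y - h x) \<bullet> b) *\<^sub>R (A y b - A x b)) differentiable (at x)"
  proof (intro differentiable_sum ballI finite_Basis)
    fix b :: 'b assume "b \<in> Basis"
    then obtain A' where "((\<lambda>y. A y b) has_derivative A') (at x)"
      using A by (auto simp: differentiable_def)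
    then have "((\<lambda>y. A y b - A x b) has_derivative A') (at x)"
      using has_derivative_diff[OF _ has_derivative_const[of "A x b"]] by fastforce
    moreover have "isCont (\<lambda>y. (h y - h x) \<bullet> b) x" using cont by (intro continuous_intros)
    ultimately show "(\<lambda>y. ((h y - h x) \<bullet> b) *\<^sub>R (A y b - A x b)) differentiable (at x)"
      using has_derivative_vanishing_product[of "\<lambda>y. A y b - A x b" A' x "\<lambda>y. (h y - h x) \<bullet> b"]
      by (auto simp: differentiable_def)
  qed
  moreover
  have dB: "(\<lambda>y. B (k y)) differentiable (at x)" if "k differentiable (at x)" for k :: "'a \<Rightarrow> 'b"
    using that bounded_linear.has_derivative[OF bl] unfolding differentiable_def by blast
  ultimately have "q differentiable (at x)"
    unfolding q_def by (intro differentiable_diff dB r)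
  then have "(\<lambda>y. h x + q y) differentiable (at x)"
    by (intro differentiable_add differentiable_const)
  then obtain q' where "((\<lambda>y. h x + q y) has_derivative q') (at x)" by (auto simp: differentiable_def)
  from has_derivative_transform_within_open[OF this assms(1,2) q[symmetric]]
  show ?thesis by (auto simp: differentiable_def)
qed

text \<open>This is what makes the inverse of a smooth map smooth, without formulas for inverse matrices.\<close>

lemma diff_upto_linear_solve:
  fixes A :: "'a::euclidean_space \<Rightarrow> 'b::euclidean_space \<Rightarrow> 'b"
  assumes "open S"
    and lin: "\<And>y. y \<in> S \<Longrightarrow> linear (A y)"
    and bound: "\<And>y h. y \<in> S \<Longrightarrow> norm h \<le> C * norm (A y h)"
    and "\<And>b. b \<in> Basis \<Longrightarrow> diff_upto n S (\<lambda>y. A y b)"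
    and "diff_upto n S u"
    and "\<And>y. y \<in> S \<Longrightarrow> A y (h y) = u y"
  shows "diff_upto n S h"
  using assms(4-6)
proof (induction n arbitrary: u h)
  case (0 u h)
  show ?case
    unfolding diff_upto.simps
  proof
    fix x assume "x \<in> S"
    show "h differentiable (at x)"
    proof (rule differentiable_linear_solve[OF \<open>open S\<close> \<open>x \<in> S\<close> lin bound _ _ 0(3)])
      show "(\<lambda>y. A y b) differentiable (at x)" if "b \<in> Basis" for b
        using 0(1)[OF that] \<open>x \<in> S\<close> by simp
      show "u differentiable (at x)" using 0(2) \<open>x \<in> S\<close> by simp
    qed
  qed
next
  case (Suc n u h)
  note A = diff_upto_imp_has_derivative[OF Suc.prems(1)]
  note u = diff_upto_imp_has_derivative[OF Suc.prems(2)]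
  have hn: "diff_upto n S h"
    by (rule Suc.IH[OF _ _ Suc.prems(3)]) (use Suc.prems(1,2)[THEN diff_upto_Suc_imp] in auto)
  note h = diff_upto_imp_has_derivative[OF hn]
  \<comment> \<open>Differentiating \<open>A y (h y) = u y\<close> shows that the partial derivatives of \<open>h\<close> solve an
    equation with the same \<open>A\<close>.\<close>
  have eq: "A y (frechet_derivative h (at y) v) =
      frechet_derivative u (at y) v - (\<Sum>b\<in>Basis. (h y \<bullet> b) *\<^sub>R frechet_derivative (\<lambda>y. A y b) (at y) v)"
    if y: "y \<in> S" for y v
  proof -
    have "((\<lambda>y. \<Sum>b\<in>Basis. (h y \<bullet> b) *\<^sub>R A y b) has_derivative
        (\<lambda>v. \<Sum>b\<in>Basis. (h y \<bullet> b) *\<^sub>R frechet_derivative (\<lambda>y. A y b) (at y) v +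
              (frechet_derivative h (at y) v \<bullet> b) *\<^sub>R A y b)) (at y)"
      by (intro has_derivative_sum has_derivative_scaleR has_derivative_inner_left h A y)
    moreover have "(\<Sum>b\<in>Basis. (h y \<bullet> b) *\<^sub>R A y b) = u y" if "y \<in> S" for y
      using Suc.prems(3)[OF that] linear_basis_expansion[OF lin[OF that], of "h y"] by simp
    ultimately have "(u has_derivative
        (\<lambda>v. \<Sum>b\<in>Basis. (h y \<bullet> b) *\<^sub>R frechet_derivative (\<lambda>y. A y b) (at y) v +
              (frechet_derivative h (at y) v \<bullet> b) *\<^sub>R A y b)) (at y)"
      using has_derivative_transform_within_open[OF _ \<open>open S\<close> y] by blast
    from frechet_derivative_at[OF this]
    have "frechet_derivative u (at y) v =
        (\<Sum>b\<in>Basis. (h y \<bullet> b) *\<^sub>R frechet_derivative (\<lambda>y. A y b) (at y) v) +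
        (\<Sum>b\<in>Basis. (frechet_derivative h (at y) v \<bullet> b) *\<^sub>R A y b)"
      by (simp add: fun_eq_iff sum.distrib)
    also have "(\<Sum>b\<in>Basis. (frechet_derivative h (at y) v \<bullet> b) *\<^sub>R A y b) =
        A y (frechet_derivative h (at y) v)"
      by (rule linear_basis_expansion[OF lin[OF y], symmetric])
    finally show ?thesis by simp
  qed
  show ?case
  proof (rule diff_upto_SucI[OF \<open>open S\<close> h])
    fix v :: 'a assume v: "v \<in> Basis"
    show "diff_upto n S (\<lambda>y. frechet_derivative h (at y) v)"
    proof (rule Suc.IH[OF _ _ eq])
      show "diff_upto n S (\<lambda>y. A y b)" if "b \<in> Basis" for b
        using Suc.prems(1)[OF that] by (rule diff_upto_Suc_imp)
      show "diff_upto n S (\<lambda>y. frechet_derivative u (at y) v -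
          (\<Sum>b\<in>Basis. (h y \<bullet> b) *\<^sub>R frechet_derivative (\<lambda>y. A y b) (at y) v))"
        using Suc.prems(1,2) v hn
        by (intro diff_upto_diff diff_upto_sum diff_upto_scaleR
            diff_upto_bounded_linear[OF _ bounded_linear_inner_left] \<open>open S\<close>) auto
    qed auto
  qed auto
qed

section \<open>Smooth perturbations of the identity\<close>

text \<open>A quantitative substitute for the inverse function theorem: the set on which \<open>F\<close> is injective
  and the size of the balls in its image depend on nothing else about \<open>F\<close>.  This uniformity is
  needed for the whole family of actions near a given time. \<close>

definition near_id_on :: "'a::real_normed_vector set \<Rightarrow> ('a \<Rightarrow> 'a) \<Rightarrow> bool" where
  "near_id_on B F \<longleftrightarrow> (\<forall>x \<in> B. \<forall>y \<in> B. norm ((F x - F y) - (x - y)) \<le> norm (x - y) / 2)"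

lemma near_id_onD:
  "near_id_on B F \<Longrightarrow> x \<in> B \<Longrightarrow> y \<in> B \<Longrightarrow> norm ((F x - F y) - (x - y)) \<le> norm (x - y) / 2"
  by (simp add: near_id_on_def)

lemma near_id_on_subset: "near_id_on B F \<Longrightarrow> A \<subseteq> B \<Longrightarrow> near_id_on A F"
  by (auto simp: near_id_on_def)

lemma near_id_on_lower:
  assumes "near_id_on B F" "x \<in> B" "y \<in> B"
  shows "norm (x - y) \<le> 2 * norm (F x - F y)"
proof -
  have "norm (x - y) \<le> norm (F x - F y) + norm ((F x - F y) - (x - y))"
    using norm_triangle_ineq4[of "F x - F y" "(F x - F y) - (x - y)"] by simp
  then show ?thesis using near_id_onD[OF assms] by simp
qed

lemma near_id_on_upper:
  assumes "near_id_on B F" "x \<in> B" "y \<in> B"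
  shows "norm (F x - F y) \<le> 2 * norm (x - y)"
proof -
  have "norm (F x - F y) \<le> norm (x - y) + norm ((F x - F y) - (x - y))"
    using norm_triangle_ineq[of "x - y" "(F x - F y) - (x - y)"] by simp
  then show ?thesis using near_id_onD[OF assms] norm_ge_zero[of "x - y"] by linarith
qed

lemma near_id_on_inj: "near_id_on B F \<Longrightarrow> inj_on F B"
  by (rule inj_onI) (use near_id_on_lower in fastforce)

lemma near_id_on_continuous:
  assumes "near_id_on B F"
  shows "continuous_on B F"
proof -
  have "2-lipschitz_on B F"
    by (rule lipschitz_onI) (use near_id_on_upper[OF assms] in \<open>auto simp: dist_norm\<close>)
  then show ?thesis by (rule lipschitz_on_continuous_on)
qed

text \<open>A solution of \<open>F z = y\<close> is a fixed point of the contraction \<open>z \<mapsto> z - F z + y\<close>.\<close>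

lemma near_id_on_surj:
  fixes F :: "'a::banach \<Rightarrow> 'a"
  assumes F: "near_id_on B F" and sub: "cball x r \<subseteq> B" and y: "norm (y - F x) \<le> r / 2"
  shows "\<exists>z \<in> cball x r. F z = y"
proof -
  have "r \<ge> 0" using y norm_ge_zero[of "y - F x"] by linarith
  define T where "T = (\<lambda>z. z - F z + y)"
  have lip: "norm (T z - T w) \<le> norm (z - w) / 2" if "z \<in> cball x r" "w \<in> cball x r" for z w
  proof -
    have "norm (T z - T w) = norm ((F z - F w) - (z - w))"
      unfolding T_def by (subst norm_minus_commute) (simp add: algebra_simps)
    then show ?thesis using near_id_onD[OF F, of z w] that sub by (auto simp: subset_iff)
  qed
  have "\<exists>!z. z \<in> cball x r \<and> T z = z"
  proof (rule Banach_fix[of _ "1/2"])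
    show "complete (cball x r)" by (simp add: complete_eq_closed)
    show "cball x r \<noteq> {}" using \<open>r \<ge> 0\<close> by simp
    show "T ` cball x r \<subseteq> cball x r"
    proof
      fix w assume "w \<in> T ` cball x r"
      then obtain z where z: "z \<in> cball x r" "w = T z" by blast
      have "T z - x = (T z - T x) + (y - F x)" by (simp add: T_def)
      then have "norm (T z - x) \<le> norm (T z - T x) + norm (y - F x)"
        by (metis norm_triangle_ineq)
      also have "\<dots> \<le> r" using lip[OF z(1), of x] z(1) y \<open>r \<ge> 0\<close>
        by (simp add: dist_norm norm_minus_commute)
      finally show "w \<in> cball x r" using z by (simp add: dist_norm norm_minus_commute)
    qed
    show "dist (T z) (T w) \<le> 1/2 * dist z w" if "z \<in> cball x r" "w \<in> cball x r" for z w
      using lip[OF that] by (simp add: dist_norm)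
  qed auto
  then obtain z where "z \<in> cball x r" "T z = z" by blast
  then show ?thesis by (auto simp: T_def)
qed

lemma near_id_on_open_image:
  fixes F :: "'a::banach \<Rightarrow> 'a"
  assumes F: "near_id_on B F" and "open B"
  shows "open (F ` B)"
  unfolding open_contains_cball
proof
  fix y assume "y \<in> F ` B"
  then obtain x where x: "x \<in> B" "y = F x" by blast
  obtain r where r: "r > 0" "cball x r \<subseteq> B" using \<open>open B\<close> x(1) open_contains_cball by blast
  have "cball y (r / 2) \<subseteq> F ` B"
  proof
    fix w assume "w \<in> cball y (r / 2)"
    then have "norm (w - F x) \<le> r / 2" using x by (simp add: dist_norm norm_minus_commute)
    from near_id_on_surj[OF F r(2) this] show "w \<in> F ` B" using r by blast
  qed
  then show "\<exists>e>0. cball y e \<subseteq> F ` B" using r by (intro exI[of _ "r/2"]) auto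
qed

lemma near_id_on_inverse_continuous:
  assumes F: "near_id_on B F"
  shows "continuous_on (F ` B) (inv_into B F)"
proof -
  have "2-lipschitz_on (F ` B) (inv_into B F)"
    by (rule lipschitz_onI)
       (use near_id_on_lower[OF F] in \<open>auto simp: dist_norm inv_into_f_f[OF near_id_on_inj[OF F]]\<close>)
  then show ?thesis by (rule lipschitz_on_continuous_on)
qed

text \<open>The lower Lipschitz bound passes to the derivative, which is therefore invertible.\<close>

lemma near_id_on_derivative:
  assumes F: "near_id_on B F" and "open B" "x \<in> B" and F': "(F has_derivative F') (at x)"
  shows "norm h \<le> 2 * norm (F' h)"
proof -
  have lin: "linear F'" using F' has_derivative_linear by blast
  have "((\<lambda>t. F (x + t *\<^sub>R h)) has_derivative (\<lambda>t. F' (t *\<^sub>R h))) (at 0)"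
    by (rule has_derivative_compose[where g = F, of "\<lambda>t. x + t *\<^sub>R h" "\<lambda>t. t *\<^sub>R h"])
       (use F' in \<open>auto intro!: derivative_eq_intros\<close>)
  then have "((\<lambda>t. norm (F (x + t *\<^sub>R h) - F x - t *\<^sub>R F' h) / norm t) \<longlongrightarrow> 0) (at 0)"
    by (simp add: has_derivative_iff_norm linear_scale[OF lin])
  moreover have "\<forall>\<^sub>F t in at 0. norm (F (x + t *\<^sub>R h) - F x - t *\<^sub>R F' h) / norm t =
      norm ((F (x + t *\<^sub>R h) - F x) /\<^sub>R t - F' h)"
  proof (rule eventually_at_topological[THEN iffD2], intro exI[of _ UNIV] conjI ballI impI)
    fix t :: real assume "t \<noteq> 0"
    then have "(F (x + t *\<^sub>R h) - F x) /\<^sub>R t - F' h = (F (x + t *\<^sub>R h) - F x - t *\<^sub>R F' h) /\<^sub>R t"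
      by (simp add: scaleR_diff_right)
    then show "norm (F (x + t *\<^sub>R h) - F x - t *\<^sub>R F' h) / norm t =
      norm ((F (x + t *\<^sub>R h) - F x) /\<^sub>R t - F' h)" by (simp add: divide_inverse_commute)
  qed auto
  ultimately have "((\<lambda>t. norm ((F (x + t *\<^sub>R h) - F x) /\<^sub>R t - F' h)) \<longlongrightarrow> 0) (at 0)"
    by (simp cong: tendsto_cong)
  then have lim: "((\<lambda>t. (F (x + t *\<^sub>R h) - F x) /\<^sub>R t) \<longlongrightarrow> F' h) (at 0)"
    by (metis LIM_zero_cancel tendsto_norm_zero_cancel)
  have "((\<lambda>t. x + t *\<^sub>R h) \<longlongrightarrow> x + 0 *\<^sub>R h) (at 0)" by (intro tendsto_intros)
  then have "\<forall>\<^sub>F t in at 0. x + t *\<^sub>R h \<in> B"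
    using topological_tendstoD[OF _ \<open>open B\<close>] \<open>x \<in> B\<close> by fastforce
  then have "\<forall>\<^sub>F t in at 0. norm h \<le> 2 * norm ((F (x + t *\<^sub>R h) - F x) /\<^sub>R t)"
    using eventually_neq_at_within[of 0 0 UNIV]
  proof (eventually_elim, goal_cases)
    case (1 t)
    have "\<bar>t\<bar> * norm h \<le> 2 * norm (F (x + t *\<^sub>R h) - F x)"
      using near_id_on_lower[OF F 1(1) \<open>x \<in> B\<close>] by simp
    then show ?case using 1(2) by (simp add: divide_simps mult.commute)
  qed
  then show ?thesis
    by (rule tendsto_lowerbound[OF tendsto_mult_left[OF tendsto_norm[OF lim]]]) simp
qed

text \<open>The partial derivative \<open>\<partial>\<^sub>v G\<close> of the inverse \<open>G\<close> solves the linear system \<open>DF (G y) h = v\<close>, whose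
  coefficients have as many derivatives as \<open>G\<close>; so \<open>G\<close> gains one derivative at a time.\<close>

lemma smooth_on_inverse_near_id:
  fixes F :: "'a::euclidean_space \<Rightarrow> 'a"
  assumes F: "near_id_on B F" and sm: "smooth_on B F"
  shows "smooth_on (F ` B) (inv_into B F)"
proof -
  define G where "G = inv_into B F"
  have "open B" using sm smooth_on_open by blast
  have op: "open (F ` B)" by (rule near_id_on_open_image[OF F \<open>open B\<close>])
  have GF: "G (F x) = x" if "x \<in> B" for x
    using that near_id_on_inj[OF F] by (simp add: G_def)
  have GB: "G ` F ` B \<subseteq> B" using GF by auto
  have FD: "(F has_derivative frechet_derivative F (at x)) (at x)" if "x \<in> B" for x
    using sm that diff_upto_imp_has_derivative unfolding smooth_on_iff_diff_upto by blast
  have bound: "norm h \<le> 2 * norm (frechet_derivative F (at x) h)" if "x \<in> B" for x h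
    by (rule near_id_on_derivative[OF F \<open>open B\<close> that FD[OF that]])
  have lin: "linear (frechet_derivative F (at x))" if "x \<in> B" for x
    using FD[OF that] has_derivative_linear by blast
  have ex: "\<exists>G'. (G has_derivative G') (at (F x)) \<and> (\<forall>v. frechet_derivative F (at x) (G' v) = v)"
    if x: "x \<in> B" for x
  proof -
    have "inj (frechet_derivative F (at x))"
      unfolding linear_injective_0[OF lin[OF x]]
    proof (intro allI impI)
      fix v assume "frechet_derivative F (at x) v = 0"
      then show "v = 0" using bound[OF x, of v] by simp
    qed
    then obtain G' where "linear G'" "frechet_derivative F (at x) \<circ> G' = id"
      using linear_surjective_right_inverse[OF lin[OF x]]
        linear_injective_imp_surjective[OF lin[OF x]] by blast
    moreover from this have "(G has_derivative G') (at (F x))"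
      using has_derivative_inverse_strong[OF \<open>open B\<close> x near_id_on_continuous[OF F] _ FD[OF x]] GF
      by blast
    ultimately show ?thesis by (metis comp_apply id_apply)
  qed
  have GD: "(G has_derivative frechet_derivative G (at y)) (at y)"
    and sol: "frechet_derivative F (at (G y)) (frechet_derivative G (at y) v) = v"
    if "y \<in> F ` B" for y v
    using that ex GF frechet_derivative_at by (metis imageE)+
  have "diff_upto n (F ` B) G" for n
  proof (induction n)
    case 0
    then show ?case using diff_upto_0I[OF GD] .
  next
    case (Suc n)
    show ?case
    proof (rule diff_upto_SucI[OF op GD])
      fix v :: 'a assume "v \<in> Basis"
      show "diff_upto n (F ` B) (\<lambda>y. frechet_derivative G (at y) v)"
      proof (rule diff_upto_linear_solve[where C = 2 and u = "\<lambda>_. v" and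
              A = "\<lambda>y. frechet_derivative F (at (G y))", OF op])
        fix b :: 'a assume "b \<in> Basis"
        then have "diff_upto n B (\<lambda>x. frechet_derivative F (at x) b)"
          using sm unfolding smooth_on_iff_diff_upto by (metis diff_upto.simps(2))
        then show "diff_upto n (F ` B) (\<lambda>y. frechet_derivative F (at (G y)) b)"
          using diff_upto_compose[OF op Suc _ GB] by blast
      next
        show "linear (frechet_derivative F (at (G y)))" if "y \<in> F ` B" for y
          using lin GB that by blast
        show "norm h \<le> 2 * norm (frechet_derivative F (at (G y)) h)" if "y \<in> F ` B" for y h
          using bound GB that by blast
        show "diff_upto n (F ` B) (\<lambda>y. v)" by (rule diff_upto_const[OF op])
        show "frechet_derivative F (at (G y)) (frechet_derivative G (at y) v) = v"
          if "y \<in> F ` B" for y using sol[OF that] .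
      qed
    qed
  qed
  then show ?thesis using op unfolding smooth_on_iff_diff_upto G_def by blast
qed

section \<open>Averaging a circle action against its linearisation\<close>

lemma iter_deriv_snoc:
  "iter_deriv (vs @ [b]) f = (\<lambda>x. frechet_derivative (iter_deriv vs f) (at x) b)"
  by (induction vs arbitrary: f) auto

lemma smooth_on_iter_deriv_has_derivative:
  assumes "smooth_on S f" "vs \<in> lists Basis" "x \<in> S"
  shows "(iter_deriv vs f has_derivative
      (\<lambda>v. \<Sum>b\<in>Basis. (v \<bullet> b) *\<^sub>R iter_deriv (vs @ [b]) f x)) (at x)"
proof -
  have D: "(iter_deriv vs f has_derivative frechet_derivative (iter_deriv vs f) (at x)) (at x)"
    using assms unfolding smooth_on_def by (simp add: frechet_derivative_works)
  have "frechet_derivative (iter_deriv vs f) (at x) =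
      (\<lambda>v. \<Sum>b\<in>Basis. (v \<bullet> b) *\<^sub>R iter_deriv (vs @ [b]) f x)"
    unfolding iter_deriv_snoc by (rule ext) (rule linear_basis_expansion[OF has_derivative_linear[OF D]])
  with D show ?thesis by simp
qed

text \<open>Invariance of the Haar integral of the circle \<open>\<real>/\<int>\<close>.\<close>

lemma integral_periodic_shift:
  fixes h :: "real \<Rightarrow> 'a::euclidean_space"
  assumes h: "continuous_on UNIV h" and per: "\<And>t. h (t + 1) = h t" and w: "w \<in> {0..1}"
  shows "integral {0..1} (\<lambda>t. h (t + w)) = integral {0..1} h"
proof -
  have int: "h integrable_on {a..b}" for a b
    by (rule integrable_continuous_interval) (use h continuous_on_subset in blast)
  have shift: "integral {a..b} (\<lambda>t. h (t + c)) = integral {a + c..b + c} h" for a b c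
    using integral_shift[of a c b h] h continuous_on_subset by (simp add: o_def) blast
  have "integral {0..1} (\<lambda>t. h (t + w)) = integral {w..1 + w} h" using shift[of 0 1 w] by simp
  also have "\<dots> = integral {w..1} h + integral {1..1 + w} h"
    using Henstock_Kurzweil_Integration.integral_combine[of w 1 "1 + w" h] w int by simp
  also have "integral {1..1 + w} h = integral {0..w} h"
    using shift[of 0 w 1] per by (simp add: add.commute)
  also have "integral {w..1} h + integral {0..w} h = integral {0..1} h"
    using Henstock_Kurzweil_Integration.integral_combine[of 0 w 1 h] w int by (simp add: add.commute)
  finally show ?thesis .
qed

text \<open>The coordinate expression \<open>f\<close> of a circle action that is \<open>C\<^sup>1\<close> close to a linear circle action \<open>L\<close> on
  the open set \<open>B\<close>.  The group law of \<open>f\<close> is left out, because the orbits of points of \<open>B\<close> may leave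
  \<open>B\<close>; it appears as a hypothesis on single points below.\<close>

locale averaging =
  fixes B :: "'e::euclidean_space set" and f :: "real \<Rightarrow> 'e \<Rightarrow> 'e" and L :: "real \<Rightarrow> 'e \<Rightarrow> 'e"
  assumes open_B: "open B"
    and smooth: "smooth_on B (f t)"
    and cont: "vs \<in> lists Basis \<Longrightarrow> continuous_on (B \<times> UNIV) (\<lambda>(x, t). iter_deriv vs (f t) x)"
    and periodic: "f (t + 1) = f t"
    and L_linear: "linear (L t)"
    and L_add: "L (s + t) v = L s (L t v)"
    and L_0: "L 0 v = v"
    and L_periodic: "L (t + 1) v = L t v"
    and L_cont: "continuous_on UNIV (\<lambda>t. L t v)"
    and near: "x \<in> B \<Longrightarrow> y \<in> B \<Longrightarrow> t \<in> {0..1} \<Longrightarrow> norm (L (- t) (f t x - f t y) - (x - y)) \<le> norm (x - y) / 2"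
begin

definition average :: "'e \<Rightarrow> 'e" where
  "average x = integral {0..1} (\<lambda>t. L (- t) (f t x))"

text \<open>The derivative of the average, obtained by differentiation under the integral sign
  (\<open>iter_deriv_average\<close>).\<close>

definition average_deriv :: "'e list \<Rightarrow> 'e \<Rightarrow> 'e" where
  "average_deriv vs x = integral {0..1} (\<lambda>t. L (- t) (iter_deriv vs (f t) x))"

definition invariant_vectors :: "'e set" where
  "invariant_vectors = {v. \<forall>t \<in> {0..1}. L t v = v}"

lemma subspace_invariant_vectors: "subspace invariant_vectors"
  unfolding subspace_def invariant_vectors_def
  using linear_0[OF L_linear] linear_add[OF L_linear] linear_scale[OF L_linear] by auto

lemma L_neg_cont: "continuous_on UNIV (\<lambda>t. L (- t) v)"
  using continuous_on_compose2[OF L_cont, of UNIV uminus v] continuous_on_minus[OF continuous_on_id]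
  by auto

lemma continuous_on_L:
  assumes "continuous_on (S \<times> UNIV) (\<lambda>(x, t). g x t)"
  shows "continuous_on (S \<times> UNIV) (\<lambda>(x, t). L (- t) (g x t))"
proof -
  have "continuous_on (S \<times> UNIV) (\<lambda>p. L (- snd p) b)" for b
    by (rule continuous_on_compose2[OF L_neg_cont continuous_on_snd[OF continuous_on_id]]) auto
  moreover have "continuous_on (S \<times> UNIV) (\<lambda>p. g (fst p) (snd p))"
    using assms by (simp add: case_prod_unfold)
  ultimately have "continuous_on (S \<times> UNIV)
      (\<lambda>p. \<Sum>b\<in>Basis. (g (fst p) (snd p) \<bullet> b) *\<^sub>R L (- snd p) b)"
    by (intro continuous_intros)
  then show ?thesis
    by (simp add: case_prod_unfold flip: linear_basis_expansion[OF L_linear])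
qed

lemma integrand_cont:
  "vs \<in> lists Basis \<Longrightarrow> continuous_on (B \<times> UNIV) (\<lambda>(x, t). L (- t) (iter_deriv vs (f t) x))"
  by (rule continuous_on_L[OF cont])

lemma integrand_cont_line:
  assumes "vs \<in> lists Basis" "x \<in> B"
  shows "continuous_on UNIV (\<lambda>t. L (- t) (iter_deriv vs (f t) x))"
  using continuous_on_compose2[OF integrand_cont[OF assms(1)], of UNIV "\<lambda>t. (x, t)"] assms(2)
  by (simp add: continuous_on_Pair continuous_on_const continuous_on_id image_subset_iff)

lemma integrand_integrable:
  assumes "vs \<in> lists Basis" "x \<in> B"
  shows "(\<lambda>t. L (- t) (iter_deriv vs (f t) x)) integrable_on {a..b}"
  by (rule integrable_continuous_interval)
     (rule continuous_on_subset[OF integrand_cont_line[OF assms]], simp)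

text \<open>The Leibniz rule.  It asks for an integrand with values in bounded linear maps, which is
  assembled from the partial derivatives.\<close>

lemma average_deriv_has_derivative:
  assumes vs: "vs \<in> lists Basis" and x: "x \<in> B"
  shows "(average_deriv vs has_derivative
      (\<lambda>v. \<Sum>b\<in>Basis. (v \<bullet> b) *\<^sub>R average_deriv (vs @ [b]) x)) (at x)"
proof -
  obtain r where r: "r > 0" "ball x r \<subseteq> B" using open_B x openE by blast
  define D where "D = (\<lambda>y t. \<Sum>b\<in>Basis.
      blinfun_scaleR_left (L (- t) (iter_deriv (vs @ [b]) (f t) y)) o\<^sub>L blinfun_inner_left b)"
  have D_apply: "blinfun_apply (D y t) v =
      (\<Sum>b\<in>Basis. (v \<bullet> b) *\<^sub>R L (- t) (iter_deriv (vs @ [b]) (f t) y))" for y t v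
    by (simp add: D_def blinfun.sum_left)
  have snoc: "vs @ [b] \<in> lists Basis" if "b \<in> Basis" for b using vs that by auto
  have D_cont: "continuous_on (B \<times> UNIV) (\<lambda>(y, t). D y t)"
    unfolding D_def case_prod_unfold
    by (intro continuous_on_sum bounded_bilinear.continuous_on[OF bounded_bilinear_blinfun_compose]
        bounded_linear.continuous_on[OF bounded_linear_blinfun_scaleR_left] continuous_on_const
        integrand_cont[OF snoc, unfolded case_prod_unfold])
  have "((\<lambda>y. integral (cbox 0 1) (\<lambda>t. L (- t) (iter_deriv vs (f t) y))) has_derivative
      integral (cbox 0 1) (D x)) (at x within ball x r)"
  proof (rule leibniz_rule)
    fix y t assume y: "y \<in> ball x r"
    have "((\<lambda>y. L (- t) (iter_deriv vs (f t) y)) has_derivative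
        (\<lambda>v. L (- t) (\<Sum>b\<in>Basis. (v \<bullet> b) *\<^sub>R iter_deriv (vs @ [b]) (f t) y))) (at y)"
      using bounded_linear.has_derivative[OF L_linear[unfolded linear_conv_bounded_linear]
          smooth_on_iter_deriv_has_derivative[OF smooth vs]] y r by blast
    moreover have "(\<lambda>v. L (- t) (\<Sum>b\<in>Basis. (v \<bullet> b) *\<^sub>R iter_deriv (vs @ [b]) (f t) y)) =
        blinfun_apply (D y t)"
      by (simp add: fun_eq_iff D_apply linear_sum[OF L_linear] linear_scale[OF L_linear])
    ultimately show "((\<lambda>y. L (- t) (iter_deriv vs (f t) y)) has_derivative blinfun_apply (D y t))
        (at y within ball x r)"
      by (metis has_derivative_at_withinI)
  next
    show "(\<lambda>t. L (- t) (iter_deriv vs (f t) y)) integrable_on cbox 0 1" if "y \<in> ball x r" for y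
      using integrand_integrable[OF vs, of y] that r by auto
    show "continuous_on (ball x r \<times> cbox 0 1) (\<lambda>(y, t). D y t)"
      by (rule continuous_on_subset[OF D_cont]) (use r in auto)
  qed (use r in auto)
  then have "(average_deriv vs has_derivative integral {0..1} (D x)) (at x)"
    using at_within_open[of x "ball x r"] r by (simp add: average_deriv_def[abs_def])
  moreover have "D x integrable_on {0..1}"
  proof (rule integrable_continuous_interval)
    show "continuous_on {0..1} (D x)"
      using continuous_on_compose2[OF D_cont, of "{0..1}" "\<lambda>t. (x, t)"] x
      by (simp add: continuous_on_Pair continuous_on_const continuous_on_id image_subset_iff)
  qed
  then have "blinfun_apply (integral {0..1} (D x)) v =
      (\<Sum>b\<in>Basis. (v \<bullet> b) *\<^sub>R average_deriv (vs @ [b]) x)" for v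
    using integrand_integrable[OF snoc x]
    by (simp add: blinfun_apply_integral D_apply average_deriv_def Henstock_Kurzweil_Integration.integral_sum integrable_cmul
        integral_cmul)
  ultimately show ?thesis by (metis (no_types, lifting) ext)
qed

lemma iter_deriv_average:
  assumes "vs \<in> lists Basis" "x \<in> B"
  shows "iter_deriv vs average x = average_deriv vs x"
  using assms
proof (induction vs arbitrary: x rule: rev_induct)
  case Nil
  show ?case by (simp add: average_def average_deriv_def)
next
  case (snoc b vs)
  have "(iter_deriv vs average has_derivative
      (\<lambda>v. \<Sum>b\<in>Basis. (v \<bullet> b) *\<^sub>R average_deriv (vs @ [b]) x)) (at x)"
    using snoc
    by (intro has_derivative_transform_within_open[OF average_deriv_has_derivative open_B]) auto
  from frechet_derivative_at[OF this]
  have "iter_deriv (vs @ [b]) average x = (\<Sum>c\<in>Basis. (b \<bullet> c) *\<^sub>R average_deriv (vs @ [c]) x)"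
    by (simp add: iter_deriv_snoc fun_eq_iff)
  also have "\<dots> = average_deriv (vs @ [b]) x"
  proof -
    have "b \<in> Basis" using snoc.prems by simp
    then show ?thesis by (subst sum.remove[of _ b]) (auto simp: inner_Basis intro!: sum.neutral split: if_splits)
  qed
  finally show ?case .
qed

lemma smooth_average: "smooth_on B average"
  unfolding smooth_on_def
proof (intro conjI ballI open_B)
  fix vs :: "'e list" and x assume "vs \<in> lists Basis" "x \<in> B"
  then have "(iter_deriv vs average has_derivative
      (\<lambda>v. \<Sum>b\<in>Basis. (v \<bullet> b) *\<^sub>R average_deriv (vs @ [b]) x)) (at x)"
    using iter_deriv_average
    by (intro has_derivative_transform_within_open[OF average_deriv_has_derivative open_B]) auto
  then show "iter_deriv vs average differentiable (at x)"
    unfolding differentiable_def by blast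
qed

lemma near_id_average: "near_id_on B average"
  unfolding near_id_on_def
proof (intro ballI)
  fix x y assume xy: "x \<in> B" "y \<in> B"
  note int = integrand_integrable[of "[]", simplified]
  have "average x - average y - (x - y) =
      integral {0..1} (\<lambda>t. L (- t) (f t x) - L (- t) (f t y) - (x - y))"
  proof -
    have "(\<lambda>t::real. x - y) integrable_on {0..1}"
      by (intro integrable_continuous_interval continuous_on_const)
    from Henstock_Kurzweil_Integration.integral_diff[OF integrable_diff[OF int[OF xy(1)] int[OF xy(2)]] this]
    show ?thesis
      by (simp add: average_def Henstock_Kurzweil_Integration.integral_diff[OF int[OF xy(1)] int[OF xy(2)]])
  qed
  also have "norm \<dots> \<le> norm (x - y) / 2 * (1 - 0)"
  proof (rule integral_bound)
    show "continuous_on {0..1} (\<lambda>t. L (- t) (f t x) - L (- t) (f t y) - (x - y))"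
      by (intro continuous_on_diff continuous_on_const
          continuous_on_subset[OF integrand_cont_line[of "[]", simplified]] xy) auto
    show "norm (L (- t) (f t x) - L (- t) (f t y) - (x - y)) \<le> norm (x - y) / 2"
      if "t \<in> {0..1}" for t
      using near[OF xy that] by (simp add: linear_diff[OF L_linear])
  qed simp
  finally show "norm (average x - average y - (x - y)) \<le> norm (x - y) / 2" by simp
qed

text \<open>\<open>L (- t) (f t (f w x)) = L w (L (- (t + w)) (f (t + w) x))\<close>, and the shift by \<open>w\<close> does not change
  the integral.\<close>

lemma average_equivariant:
  assumes x: "x \<in> B" and w: "w \<in> {0..1}" and flow: "\<And>t. f t (f w x) = f (t + w) x"
  shows "average (f w x) = L w (average x)"
proof -
  define h where "h = (\<lambda>t. L (- t) (f t x))"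
  have h: "continuous_on UNIV h"
    using integrand_cont_line[of "[]" x] x by (simp add: h_def)
  have "h (t + 1) = h t" for t
    using L_periodic[of "- (t + 1)"] periodic by (simp add: h_def)
  note shift = integral_periodic_shift[OF h this w]
  have "L (- t) (f t (f w x)) = L w (h (t + w))" for t
    using L_add[of w "- (t + w)"] by (simp add: h_def flow)
  then have "average (f w x) = integral {0..1} (L w \<circ> (\<lambda>t. h (t + w)))"
    by (simp add: average_def o_def)
  also have "\<dots> = L w (integral {0..1} (\<lambda>t. h (t + w)))"
  proof (rule integral_linear)
    show "(\<lambda>t. h (t + w)) integrable_on {0..1}"
      by (intro integrable_continuous_interval continuous_on_compose2[OF h] continuous_intros) auto
    show "bounded_linear (L w)" using L_linear linear_conv_bounded_linear by blast
  qed
  finally have "average (f w x) = L w (integral {0..1} h)" unfolding shift .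
  then show ?thesis by (simp add: average_def[of x] h_def)
qed

text \<open>By equivariance and injectivity the average turns fixed points of \<open>f\<close> into fixed vectors of \<open>L\<close>,
  in both directions.\<close>

lemma fixed_iff_average_invariant:
  assumes x: "x \<in> B" and orbit: "\<And>t. t \<in> {0..1} \<Longrightarrow> f t x \<in> B"
    and flow: "\<And>s t. f s (f t x) = f (s + t) x"
  shows "(\<forall>t \<in> {0..1}. f t x = x) \<longleftrightarrow> average x \<in> invariant_vectors"
proof
  assume "\<forall>t \<in> {0..1}. f t x = x"
  then show "average x \<in> invariant_vectors"
    using average_equivariant[OF x _ flow] by (auto simp: invariant_vectors_def)
next
  assume inv: "average x \<in> invariant_vectors"
  show "\<forall>t \<in> {0..1}. f t x = x"
  proof
    fix t :: real assume t: "t \<in> {0..1}"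
    then have "average (f t x) = average x"
      using average_equivariant[OF x t flow] inv by (auto simp: invariant_vectors_def)
    then show "f t x = x"
      using near_id_on_inj[OF near_id_average] orbit[OF t] x by (metis inj_onD)
  qed
qed

end

section \<open>Charts, slices and the dimension of a subset at a point\<close>

lemma is_chart_inj: "is_chart T c \<Longrightarrow> inj_on (coord c) (chart_dom c)"
  using openin_subset unfolding is_chart_def
  by (metis homeomorphic_imp_injective_map topspace_subtopology_subset)

lemma coord_inv_coord: "is_chart T c \<Longrightarrow> p \<in> chart_dom c \<Longrightarrow> coord_inv c (coord c p) = p"
  unfolding coord_inv_def by (rule inv_into_f_f[OF is_chart_inj])

lemma coord_coord_inv: "x \<in> coord_img c \<Longrightarrow> coord c (coord_inv c x) = x"
  by (simp add: coord_inv_def coord_img_def f_inv_into_f)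

lemma coord_inv_in: "x \<in> coord_img c \<Longrightarrow> coord_inv c x \<in> chart_dom c"
  by (simp add: coord_inv_def coord_img_def inv_into_into)

lemma coord_in: "p \<in> chart_dom c \<Longrightarrow> coord c p \<in> coord_img c"
  by (simp add: coord_img_def)

lemma is_chart_dom_subset: "is_chart T c \<Longrightarrow> chart_dom c \<subseteq> topspace T"
  by (simp add: is_chart_def openin_subset)

lemma is_chart_continuous_coord:
  "is_chart T c \<Longrightarrow> continuous_map (subtopology T (chart_dom c)) euclidean (coord c)"
  using homeomorphic_imp_continuous_map continuous_map_into_fulltopology
  unfolding is_chart_def by blast

lemma is_chart_continuous_coord_inv:
  assumes "is_chart T c"
  shows "continuous_map (top_of_set (coord_img c)) (subtopology T (chart_dom c)) (coord_inv c)"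
proof -
  obtain g where g: "homeomorphic_maps (subtopology T (chart_dom c)) (top_of_set (coord_img c)) (coord c) g"
    using assms homeomorphic_map_maps unfolding is_chart_def by blast
  then have cont: "continuous_map (top_of_set (coord_img c)) (subtopology T (chart_dom c)) g"
    and fg: "\<forall>y \<in> coord_img c. coord c (g y) = y"
    by (auto simp: homeomorphic_maps_def)
  have "g y = coord_inv c y" if "y \<in> coord_img c" for y
  proof -
    have "g y \<in> chart_dom c" using continuous_map_funspace[OF cont] that by auto
    then show ?thesis using coord_inv_coord[OF assms] fg that by metis
  qed
  then show ?thesis using continuous_map_eq[OF cont] by simp
qed

lemma is_chart_open_image:
  assumes "is_chart T c" "openin T W" "W \<subseteq> chart_dom c"
  shows "open (coord c ` W)"
proof -
  have "openin (subtopology T (chart_dom c)) W"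
    using assms openin_subset_topspace_eq by (simp add: openin_subtopology) blast
  then have "openin (top_of_set (coord_img c)) (coord c ` W)"
    using assms(1) homeomorphic_imp_open_map unfolding is_chart_def open_map_def by blast
  then show ?thesis using assms(1) openin_open_eq unfolding is_chart_def by blast
qed

lemma is_chart_open_preimage:
  assumes "is_chart T c" "open X"
  shows "openin T {p \<in> chart_dom c. coord c p \<in> X}"
proof -
  have "openin (subtopology T (chart_dom c)) {p \<in> topspace (subtopology T (chart_dom c)). coord c p \<in> X}"
    using openin_continuous_map_preimage[OF is_chart_continuous_coord[OF assms(1)], of X] assms(2)
    by simp
  moreover have "topspace (subtopology T (chart_dom c)) = chart_dom c"
    using is_chart_dom_subset[OF assms(1)] by auto
  ultimately show ?thesis
    using assms(1) openin_trans_full unfolding is_chart_def by metis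
qed

text \<open>The charts of which \<^const>\<open>submanifold\<close> speaks.\<close>

definition slice_chart :: "('a, 'e::euclidean_space) manifold \<Rightarrow> nat \<Rightarrow> 'a set \<Rightarrow> ('a, 'e) chart \<Rightarrow> bool"
  where "slice_chart M d S c \<longleftrightarrow> is_chart (mtop M) c \<and> (\<forall>c' \<in> atlas M. compatible c c') \<and>
    (\<exists>V. subspace V \<and> dim V = d \<and> coord c ` (chart_dom c \<inter> S) = coord_img c \<inter> V)"

lemma submanifold_iff_slice_chart:
  "submanifold M d S \<longleftrightarrow> S \<subseteq> points M \<and> (\<forall>p \<in> S. \<exists>c. slice_chart M d S c \<and> p \<in> chart_dom c)"
  unfolding submanifold_def slice_chart_def by blast

text \<open>Passing from one slice chart to another maps an open piece of one slice injectively and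
  continuously into the other slice, so that invariance of dimension applies.\<close>

lemma slice_chart_dim_le:
  assumes c: "slice_chart M d S c" and c': "slice_chart M d' S c'"
    and p: "p \<in> chart_dom c" "p \<in> chart_dom c'" "p \<in> S"
  shows "d \<le> d'"
proof -
  obtain V where V: "subspace V" "dim V = d" "coord c ` (chart_dom c \<inter> S) = coord_img c \<inter> V"
    using c unfolding slice_chart_def by blast
  obtain V' where V': "subspace V'" "dim V' = d'" "coord c' ` (chart_dom c' \<inter> S) = coord_img c' \<inter> V'"
    using c' unfolding slice_chart_def by blast
  have ch: "is_chart (mtop M) c" "is_chart (mtop M) c'" using c c' by (auto simp: slice_chart_def)
  define W where "W = chart_dom c \<inter> chart_dom c'"
  define A where "A = coord c ` (W \<inter> S)"
  have W: "openin (mtop M) W"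
    using ch unfolding W_def is_chart_def by (intro openin_Int) auto
  have A_eq: "A = coord c ` W \<inter> V"
  proof -
    have "A = coord c ` W \<inter> coord c ` (chart_dom c \<inter> S)"
      unfolding A_def using is_chart_inj[OF ch(1)] by (auto simp: W_def inj_on_def)
    also have "\<dots> = coord c ` W \<inter> V" using V(3) by (auto simp: W_def coord_img_def)
    finally show ?thesis .
  qed
  have A_inv: "coord_inv c x \<in> W \<inter> S" if "x \<in> A" for x
    using that coord_inv_coord[OF ch(1)] by (auto simp: A_def W_def)
  have A_img: "A \<subseteq> coord_img c" by (auto simp: A_def W_def coord_img_def)
  have "dim V \<le> dim V'"
  proof (rule invariance_of_dimension_subspaces[where f = "coord c' \<circ> coord_inv c" and S = A])
    show "openin (top_of_set V) A"
      using is_chart_open_image[OF ch(1) W] by (auto simp: A_eq W_def openin_open_Int Int_commute)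
    show "continuous_on A (coord c' \<circ> coord_inv c)"
    proof -
      have "continuous_map (top_of_set A) (mtop M) (coord_inv c)"
        using continuous_map_from_subtopology_mono[OF continuous_map_into_fulltopology[OF
              is_chart_continuous_coord_inv[OF ch(1)]] A_img] by simp
      then have "continuous_map (top_of_set A) (subtopology (mtop M) (chart_dom c')) (coord_inv c)"
        using A_inv by (auto simp: continuous_map_in_subtopology W_def)
      then have "continuous_map (top_of_set A) euclidean (coord c' \<circ> coord_inv c)"
        by (rule continuous_map_compose[OF _ is_chart_continuous_coord[OF ch(2)]])
      then show ?thesis by simp
    qed
    show "coord c' \<circ> coord_inv c \<in> A \<rightarrow> V'"
    proof
      fix x assume "x \<in> A"
      then have "coord_inv c x \<in> chart_dom c' \<inter> S" using A_inv by (auto simp: W_def)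
      then show "(coord c' \<circ> coord_inv c) x \<in> V'" using V'(3) by (metis IntD2 comp_apply imageI)
    qed
    show "inj_on (coord c' \<circ> coord_inv c) A"
    proof (rule inj_onI)
      fix x y assume xy: "x \<in> A" "y \<in> A" "(coord c' \<circ> coord_inv c) x = (coord c' \<circ> coord_inv c) y"
      then have "coord_inv c x = coord_inv c y"
        using A_inv is_chart_inj[OF ch(2)] by (auto simp: W_def inj_on_def)
      then show "x = y" using xy A_img coord_coord_inv by (metis subsetD)
    qed
    show "A \<noteq> {}" using p by (auto simp: A_def W_def)
  qed (use V V' in auto)
  then show ?thesis using V V' by simp
qed

lemma slice_chart_dim_unique:
  assumes "slice_chart M d S c" "slice_chart M d' S c'"
    and "p \<in> chart_dom c" "p \<in> chart_dom c'" "p \<in> S"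
  shows "d = d'"
  using slice_chart_dim_le[OF assms] slice_chart_dim_le[OF assms(2,1,4,3,5)] by simp

text \<open>The average is used as a change of coordinates: a chart of the maximal atlas followed by a smooth
  map close to the identity is again one.\<close>

lemma chart_deformation:
  fixes M :: "('a, 'e::euclidean_space) manifold" and c :: "('a, 'e) chart"
  assumes atl: "\<forall>c' \<in> atlas M. is_chart (mtop M) c'"
    and c: "is_chart (mtop M) c" "\<forall>c' \<in> atlas M. compatible c c'"
    and F: "near_id_on B F" "smooth_on B F" and W: "open W" "W \<subseteq> B" "W \<subseteq> coord_img c"
  defines "c' \<equiv> ({p \<in> chart_dom c. coord c p \<in> W}, F \<circ> coord c)"
  shows "is_chart (mtop M) c'" "\<forall>c'' \<in> atlas M. compatible c' c''" "coord_img c' = F ` W"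
proof -
  define G where "G = inv_into B F"
  have "open B" using F smooth_on_open by blast
  have injF: "inj_on F B" by (rule near_id_on_inj[OF F(1)])
  have GF: "G (F x) = x" if "x \<in> B" for x using that injF by (simp add: G_def)
  have G: "smooth_on (F ` B) G" unfolding G_def by (rule smooth_on_inverse_near_id[OF F])
  have dom: "chart_dom c' = {p \<in> chart_dom c. coord c p \<in> W}" and co: "coord c' = F \<circ> coord c"
    by (auto simp: c'_def)
  have dom_open: "openin (mtop M) (chart_dom c')"
    unfolding dom by (rule is_chart_open_preimage[OF c(1) W(1)])
  have coord_dom: "coord c ` chart_dom c' = W"
    using W(3) by (auto simp: dom coord_img_def)
  then show img: "coord_img c' = F ` W"
    by (simp only: coord_img_def co image_comp[symmetric])
  have open_img: "open (F ` W)"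
    by (rule near_id_on_open_image[OF near_id_on_subset[OF F(1) W(2)] W(1)])
  have homeo: "homeomorphic_maps (subtopology (mtop M) (chart_dom c')) (top_of_set (F ` W))
      (coord c') (coord_inv c \<circ> G)"
    unfolding homeomorphic_maps_def
  proof (intro conjI ballI)
    have 1: "continuous_map (subtopology (mtop M) (chart_dom c')) (top_of_set W) (coord c)"
      using continuous_map_from_subtopology_mono[OF is_chart_continuous_coord[OF c(1)], of "chart_dom c'"]
      by (auto simp: continuous_map_in_subtopology dom)
    have 2: "continuous_map (top_of_set W) (top_of_set (F ` W)) F"
      using continuous_on_subset[OF near_id_on_continuous[OF F(1)] W(2)]
      by (simp add: continuous_map_in_subtopology)
    show "continuous_map (subtopology (mtop M) (chart_dom c')) (top_of_set (F ` W)) (coord c')"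
      unfolding co by (rule continuous_map_compose[OF 1 2])
    have 3: "continuous_map (top_of_set (F ` W)) (top_of_set W) G"
      using continuous_on_subset[OF near_id_on_inverse_continuous[OF F(1)], of "F ` W"] W(2) GF
      by (auto simp: continuous_map_in_subtopology G_def[symmetric] subset_iff)
    have 4: "continuous_map (top_of_set W) (subtopology (mtop M) (chart_dom c')) (coord_inv c)"
      using continuous_map_from_subtopology_mono[OF continuous_map_into_fulltopology[OF
              is_chart_continuous_coord_inv[OF c(1)]] W(3)] W(3)
      by (auto simp: continuous_map_in_subtopology dom coord_coord_inv coord_inv_in subset_iff)
    show "continuous_map (top_of_set (F ` W)) (subtopology (mtop M) (chart_dom c')) (coord_inv c \<circ> G)"
      by (rule continuous_map_compose[OF 3 4])
    show "(coord_inv c \<circ> G) (coord c' p) = p"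
      if "p \<in> topspace (subtopology (mtop M) (chart_dom c'))" for p
      using that W(2) GF coord_inv_coord[OF c(1)] by (auto simp: dom co subset_iff)
    show "coord c' ((coord_inv c \<circ> G) y) = y" if "y \<in> topspace (top_of_set (F ` W))" for y
      using that W GF coord_coord_inv[where c = c] by (auto simp: co subset_iff)
  qed
  show chart': "is_chart (mtop M) c'"
    unfolding is_chart_def img using dom_open open_img homeo homeomorphic_map_maps by blast
  have inv': "coord_inv c' (F x) = coord_inv c x" if "x \<in> W" for x
  proof -
    have "coord_inv c x \<in> chart_dom c'" "coord c' (coord_inv c x) = F x"
      using that W(3) coord_inv_in[where c = c] coord_coord_inv[where c = c] by (auto simp: dom co subset_iff)
    then show ?thesis using coord_inv_coord[OF chart'] by metis
  qed
  show "\<forall>c'' \<in> atlas M. compatible c' c''"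
  proof
    fix c'' assume c'': "c'' \<in> atlas M"
    let ?D = "chart_dom c' \<inter> chart_dom c''"
    have s1: "smooth_on (coord c ` (chart_dom c \<inter> chart_dom c'')) (transition c c'')"
      and s2: "smooth_on (coord c'' ` (chart_dom c \<inter> chart_dom c'')) (transition c'' c)"
      using c(2) c'' by (auto simp: compatible_def)
    have DD: "?D \<subseteq> chart_dom c \<inter> chart_dom c''" by (auto simp: dom)
    have cD: "coord c ` ?D \<subseteq> W" by (auto simp: dom)
    have D_eq: "coord c ` ?D = coord c ` (chart_dom c \<inter> chart_dom c'') \<inter> W"
      by (auto simp: dom)
    have "open (coord c ` ?D)"
      unfolding D_eq using smooth_on_open[OF s1] W(1) by (rule open_Int)
    then have op1: "open (F ` coord c ` ?D)"
      using near_id_on_open_image[OF near_id_on_subset[OF F(1)]] cD W(2) by (meson order_trans)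
    have "smooth_on (F ` coord c ` ?D) (\<lambda>y. transition c c'' (G y))"
    proof (rule smooth_on_compose[OF smooth_on_subset[OF G op1] s1])
      show "F ` coord c ` ?D \<subseteq> F ` B" using cD W(2) by blast
      show "G ` F ` coord c ` ?D \<subseteq> coord c ` (chart_dom c \<inter> chart_dom c'')"
        using cD W(2) GF DD by (force simp: subset_iff)
    qed
    then have "smooth_on (F ` coord c ` ?D) (transition c' c'')"
    proof (rule smooth_on_cong)
      fix y assume "y \<in> F ` coord c ` ?D"
      then obtain x where "x \<in> W" "y = F x" using cD by blast
      then show "transition c c'' (G y) = transition c' c'' y"
        using GF inv' W(2) by (auto simp: coord_rep_def subset_iff)
    qed
    moreover have "coord c' ` ?D = F ` coord c ` ?D" by (simp add: co image_comp)
    moreover have "smooth_on (coord c'' ` ?D) (transition c'' c')"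
    proof (rule smooth_on_cong)
      have ch'': "is_chart (mtop M) c''" using atl c'' by blast
      have eq: "transition c'' c (coord c'' p) = coord c p" if "p \<in> ?D" for p
        using that coord_inv_coord[OF ch''] by (simp add: coord_rep_def)
      have "openin (mtop M) ?D"
        using dom_open ch'' unfolding is_chart_def by (intro openin_Int) auto
      then have op2: "open (coord c'' ` ?D)"
        by (rule is_chart_open_image[OF ch'']) simp
      show "smooth_on (coord c'' ` ?D) (\<lambda>x. F (transition c'' c x))"
      proof (rule smooth_on_compose[OF smooth_on_subset[OF s2 op2] F(2)])
        show "coord c'' ` ?D \<subseteq> coord c'' ` (chart_dom c \<inter> chart_dom c'')" using DD by blast
        show "transition c'' c ` coord c'' ` ?D \<subseteq> B"
          using eq cD W(2) by (auto simp: subset_iff)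
      qed
      show "F (transition c'' c x) = transition c'' c' x" if "x \<in> coord c'' ` ?D" for x
        by (simp add: coord_rep_def co)
    qed
    ultimately show "compatible c' c''" by (simp add: compatible_def)
  qed
qed

text \<open>Convexity of the chart makes the slice connected, hence part of a single component of \<open>S\<close>.\<close>

definition locally_flat_at :: "('a, 'e::euclidean_space) manifold \<Rightarrow> nat \<Rightarrow> 'a set \<Rightarrow> 'a \<Rightarrow> bool" where
  "locally_flat_at M d S p \<longleftrightarrow>
     (\<exists>c. slice_chart M d S c \<and> convex (coord_img c) \<and> p \<in> chart_dom c)"

lemma convex_slice_connected:
  assumes c: "slice_chart M d S c" "convex (coord_img c)"
  shows "connectedin (mtop M) (chart_dom c \<inter> S)"
proof -
  obtain V where V: "subspace V" "coord c ` (chart_dom c \<inter> S) = coord_img c \<inter> V"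
    using c unfolding slice_chart_def by blast
  have ch: "is_chart (mtop M) c" using c by (simp add: slice_chart_def)
  have "convex (coord_img c \<inter> V)" using c(2) V(1) by (simp add: convex_Int subspace_imp_convex)
  then have "connectedin (top_of_set (coord_img c)) (coord_img c \<inter> V)"
    by (simp add: connectedin_subtopology convex_connected)
  then have "connectedin (mtop M) (coord_inv c ` (coord_img c \<inter> V))"
    by (rule connectedin_continuous_map_image[OF continuous_map_into_fulltopology[OF
          is_chart_continuous_coord_inv[OF ch]]])
  moreover have "coord_inv c ` (coord_img c \<inter> V) = chart_dom c \<inter> S"
    using coord_inv_coord[OF ch] by (force simp flip: V(2))
  ultimately show ?thesis by simp
qed

text \<open>In a set that is flat at each of its points the local dimension is locally constant, hence
  constant on the component \<open>C\<close>, and \<open>C\<close> is open in the set.  So \<open>C\<close> is a submanifold, of the local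
  dimension at any of its points and of no other dimension.\<close>

lemma locally_flat_component:
  assumes S: "S \<subseteq> points M" and flat: "\<And>q. q \<in> S \<Longrightarrow> \<exists>d. locally_flat_at M d S q"
    and C: "C \<in> connected_components_of (subtopology (mtop M) S)"
    and p: "p \<in> C" "locally_flat_at M d S p"
  shows "submanifold M d' C \<longleftrightarrow> d' = d"
proof -
  have CS: "C \<subseteq> S" using connected_components_of_subset[OF C] S by auto
  have C_conn: "connectedin (mtop M) C"
    using connectedin_connected_components_of[OF C] by (simp add: connectedin_subtopology)
  \<comment> \<open>A flat chart does not see the other components.\<close>
  have dom_eq: "chart_dom c \<inter> S = chart_dom c \<inter> C"
    if "slice_chart M k S c" "convex (coord_img c)" "q \<in> chart_dom c" "q \<in> C" for c k q
  proof -
    have "connectedin (subtopology (mtop M) S) (chart_dom c \<inter> S)"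
      using convex_slice_connected[OF that(1,2)] by (simp add: connectedin_subtopology)
    moreover have "\<not> disjnt C (chart_dom c \<inter> S)" using that CS by (auto simp: disjnt_def)
    ultimately have "chart_dom c \<inter> S \<subseteq> C"
      using connected_components_of_maximal[OF C] by blast
    then show ?thesis using CS by blast
  qed
  have slice_C: "slice_chart M k C c"
    if "slice_chart M k S c" "convex (coord_img c)" "q \<in> chart_dom c" "q \<in> C" for c k q
    using that(1) unfolding slice_chart_def dom_eq[OF that] .
  define P where "P k = {q \<in> C. locally_flat_at M k S q}" for k
  have P_open: "\<exists>U. openin (mtop M) U \<and> q \<in> U \<and> U \<inter> C \<subseteq> P k" if q: "q \<in> P k" for k q
  proof -
    obtain c where c: "slice_chart M k S c" "convex (coord_img c)" "q \<in> chart_dom c"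
      using q unfolding P_def locally_flat_at_def by blast
    have "chart_dom c \<inter> C \<subseteq> P k" using c unfolding P_def locally_flat_at_def by blast
    then show ?thesis using c unfolding slice_chart_def is_chart_def by blast
  qed
  have dim_unique: "k = l" if "q \<in> P k" "q \<in> P l" for k l q
    using that slice_chart_dim_unique[of M _ S] CS
    unfolding P_def locally_flat_at_def by blast
  have "C \<subseteq> P d"
  proof (rule ccontr)
    assume "\<not> C \<subseteq> P d"
    define U1 where "U1 = \<Union>{U. openin (mtop M) U \<and> U \<inter> C \<subseteq> P d}"
    define U2 where "U2 = \<Union>{U. openin (mtop M) U \<and> U \<inter> C \<subseteq> (\<Union>k\<in>-{d}. P k)}"
    have cover: "\<exists>k. q \<in> P k" if "q \<in> C" for q using flat that CS by (auto simp: P_def)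
    have U1: "U1 \<inter> C = P d"
      using P_open[of _ d] by (auto simp: U1_def P_def)
    have U2: "U2 \<inter> C = (\<Union>k\<in>-{d}. P k)"
    proof (intro equalityI subsetI)
      fix q assume "q \<in> (\<Union>k\<in>-{d}. P k)"
      then obtain k where k: "k \<noteq> d" "q \<in> P k" by auto
      from P_open[OF k(2)] k show "q \<in> U2 \<inter> C" by (fastforce simp: U2_def P_def)
    qed (auto simp: U2_def)
    have "openin (mtop M) U1" "openin (mtop M) U2" by (auto simp: U1_def U2_def)
    moreover have sub: "C \<subseteq> U1 \<union> U2"
    proof
      fix q assume "q \<in> C"
      then obtain k where "q \<in> P k" using cover by blast
      then show "q \<in> U1 \<union> U2" using U1 U2 by (cases "k = d") blast+
    qed
    moreover have "U1 \<inter> U2 \<inter> C = {}" using U1 U2 dim_unique by fastforce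
    moreover have "U1 \<inter> C \<noteq> {}" using U1 p by (auto simp: P_def)
    moreover have "U2 \<inter> C \<noteq> {}" using \<open>\<not> C \<subseteq> P d\<close> sub U1 by blast
    ultimately show False using C_conn unfolding connectedin by blast
  qed
  show ?thesis
  proof
    assume "submanifold M d' C"
    then obtain c' where c': "slice_chart M d' C c'" "p \<in> chart_dom c'"
      using p(1) unfolding submanifold_iff_slice_chart by blast
    obtain c where c: "slice_chart M d S c" "convex (coord_img c)" "p \<in> chart_dom c"
      using p(2) unfolding locally_flat_at_def by blast
    show "d' = d"
      by (rule slice_chart_dim_unique[OF c'(1) slice_C[OF c p(1)] c'(2) c(3) p(1)])
  next
    assume "d' = d"
    have "\<exists>c. slice_chart M d C c \<and> q \<in> chart_dom c" if "q \<in> C" for q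
      using that \<open>C \<subseteq> P d\<close> slice_C unfolding P_def locally_flat_at_def by blast
    then show "submanifold M d' C"
      using CS S \<open>d' = d\<close> unfolding submanifold_iff_slice_chart by blast
  qed
qed

section \<open>Homotopies of circle actions in coordinates\<close>

text \<open>The tube lemma for neighbourhood filters.  It makes statements uniform in the group element.\<close>

lemma eventually_nhds_tube:
  assumes "compact K" "\<And>t. t \<in> K \<Longrightarrow> \<forall>\<^sub>F q in nhds (y0, t). P q"
  shows "\<forall>\<^sub>F y in nhds y0. \<forall>t \<in> K. P (y, t)"
proof -
  define W where "W = \<Union>{U. open U \<and> (\<forall>q \<in> U. P q)}"
  have W: "open W" by (auto simp: W_def)
  have sub: "{y0} \<times> K \<subseteq> W"
  proof clarify
    fix t assume "t \<in> K"
    then obtain U where "open U" "(y0, t) \<in> U" "\<forall>q \<in> U. P q"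
      using assms(2) unfolding eventually_nhds by blast
    then show "(y0, t) \<in> W" unfolding W_def by (intro UnionI[of U]) simp_all
  qed
  from Elementary_Topology.tube_lemma[OF assms(1) W sub]
  obtain X where "y0 \<in> X" "open X" "X \<times> K \<subseteq> W" by blast
  moreover have "P q" if "q \<in> W" for q using that by (auto simp: W_def)
  ultimately show ?thesis unfolding eventually_nhds by (intro exI[of _ X]) (simp add: subset_iff)
qed

lemma eventually_nhds_pair_dist:
  fixes s0 :: "'a::metric_space" and x0 :: "'b::metric_space"
  assumes "\<forall>\<^sub>F y in nhds (s0, x0). P y"
  obtains \<delta> where "\<delta> > 0" "\<And>s x. dist s s0 < \<delta> \<Longrightarrow> dist x x0 < \<delta> \<Longrightarrow> P (s, x)"
proof -
  obtain A B where "eventually A (nhds s0)" "eventually B (nhds x0)" "\<And>s x. A s \<Longrightarrow> B x \<Longrightarrow> P (s, x)"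
    using assms unfolding nhds_prod eventually_prod_filter by blast
  moreover from this obtain a b where "a > 0" "b > 0"
      "\<And>s. dist s s0 < a \<Longrightarrow> A s" "\<And>x. dist x x0 < b \<Longrightarrow> B x"
    unfolding eventually_nhds_metric by blast
  ultimately show thesis using that[of "min a b"] by auto
qed

text \<open>A homotopy of circle actions, with the circle written as \<open>\<real>/\<int>\<close>: \<open>act s t\<close> is the action of the
  group element \<open>t\<close> at time \<open>s\<close>.\<close>

locale action_homotopy =
  fixes M :: "('a, 'e::euclidean_space) manifold" and act :: "real \<Rightarrow> real \<Rightarrow> 'a \<Rightarrow> 'a"
  assumes manifold: "smooth_manifold M"
    and ext: "s \<in> {0..1} \<Longrightarrow> act s t \<in> extensional (points M)"
    and act_smooth: "s \<in> {0..1} \<Longrightarrow> smooth_map M M (act s t)"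
    and act_add: "s \<in> {0..1} \<Longrightarrow> p \<in> points M \<Longrightarrow> act s (t + u) p = act s t (act s u p)"
    and act_0: "s \<in> {0..1} \<Longrightarrow> p \<in> points M \<Longrightarrow> act s 0 p = p"
    and act_periodic: "s \<in> {0..1} \<Longrightarrow> act s (t + 1) = act s t"
    and act_cont: "continuous_map (prod_topology (top_of_set {0..1}) euclideanreal) (Cinf_topology M)
                     (\<lambda>(s, t). act s t)"
begin

definition rep :: "('a, 'e) chart \<Rightarrow> real \<Rightarrow> real \<Rightarrow> 'e \<Rightarrow> 'e" where
  "rep c s t = coord_rep c c (act s t)"

text \<open>The points at which \<^const>\<open>rep\<close> is meaningful: those that \<open>act s t\<close> does not move out of the
  chart.\<close>

definition rep_dom :: "('a, 'e) chart \<Rightarrow> real \<Rightarrow> real \<Rightarrow> 'e set" where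
  "rep_dom c s t = {x \<in> coord_img c. act s t (coord_inv c x) \<in> chart_dom c}"

definition Fix :: "real \<Rightarrow> 'a set" where
  "Fix s = {p \<in> points M. \<forall>t. act s t p = p}"

lemma atlas_chart: "c \<in> atlas M \<Longrightarrow> is_chart (mtop M) c"
  using manifold by (simp add: smooth_manifold_def)

lemma atlas_compatible: "c \<in> atlas M \<Longrightarrow> \<forall>c' \<in> atlas M. compatible c c'"
  using manifold by (simp add: smooth_manifold_def)

lemma rep_eq: "rep c s t x = coord c (act s t (coord_inv c x))"
  by (simp add: rep_def coord_rep_def)

lemma coord_inv_points: "c \<in> atlas M \<Longrightarrow> x \<in> coord_img c \<Longrightarrow> coord_inv c x \<in> points M"
  by (rule subsetD[OF is_chart_dom_subset[OF atlas_chart] coord_inv_in])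

lemma rep_dom_eq:
  assumes "c \<in> atlas M"
  shows "rep_dom c s t = coord c ` (chart_dom c \<inter> act s t -` chart_dom c)"
proof (intro equalityI subsetI)
  fix x assume x: "x \<in> rep_dom c s t"
  then have "x = coord c (coord_inv c x)" "coord_inv c x \<in> chart_dom c"
    using coord_coord_inv[of x c] coord_inv_in[of x c] by (auto simp: rep_dom_def)
  then show "x \<in> coord c ` (chart_dom c \<inter> act s t -` chart_dom c)"
    using x unfolding rep_dom_def by blast
next
  fix x assume "x \<in> coord c ` (chart_dom c \<inter> act s t -` chart_dom c)"
  then show "x \<in> rep_dom c s t"
    using coord_inv_coord[OF atlas_chart[OF assms]] by (auto simp: rep_dom_def coord_in)
qed

lemma rep_smooth: "c \<in> atlas M \<Longrightarrow> s \<in> {0..1} \<Longrightarrow> smooth_on (rep_dom c s t) (rep c s t)"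
  using act_smooth[of s t] unfolding rep_dom_eq rep_def smooth_map_def by blast

text \<open>The \<open>C\<^sup>\<infinity>\<close> topology controls derivatives uniformly on a compact set, here a closed ball around
  \<open>x0\<close>.  The action at a nearby time and group element differs little from \<open>act s0 t0\<close> on the whole
  ball, and \<open>act s0 t0\<close> is smooth there.\<close>

lemma rep_jointly_continuous:
  assumes c: "c \<in> atlas M" and s0: "s0 \<in> {0..1}" and x0: "x0 \<in> rep_dom c s0 t0"
    and vs: "vs \<in> lists Basis" and \<epsilon>: "\<epsilon> > 0"
  shows "\<forall>\<^sub>F q in nhds ((s0, x0), t0). case q of ((s, x), t) \<Rightarrow> s \<in> {0..1} \<longrightarrow>
     x \<in> rep_dom c s t \<and> norm (iter_deriv vs (rep c s t) x - iter_deriv vs (rep c s0 t0) x0) < \<epsilon>"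
proof -
  let ?f = "act s0 t0"
  note ch = atlas_chart[OF c]
  have D: "smooth_on (rep_dom c s0 t0) (rep c s0 t0)" by (rule rep_smooth[OF c s0])
  obtain r where r: "r > 0" "cball x0 r \<subseteq> rep_dom c s0 t0"
    using smooth_on_open[OF D] x0 open_contains_cball by blast
  have "isCont (iter_deriv vs (rep c s0 t0)) x0"
    using D vs x0 unfolding smooth_on_def by (blast intro: differentiable_imp_continuous_within)
  then obtain \<delta>1 where \<delta>1: "\<delta>1 > 0" "\<And>x. dist x x0 < \<delta>1 \<Longrightarrow>
      dist (iter_deriv vs (rep c s0 t0) x) (iter_deriv vs (rep c s0 t0) x0) < \<epsilon> / 2"
    unfolding continuous_at_eps_delta using \<epsilon> by (metis half_gt_zero)
  define K where "K = coord_inv c ` cball x0 r"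
  have sub: "cball x0 r \<subseteq> coord_img c" using r(2) by (auto simp: rep_dom_def)
  have K_comp: "compactin (mtop M) K"
    unfolding K_def
  proof (rule image_compactin)
    show "compactin (top_of_set (coord_img c)) (cball x0 r)"
      using sub by (simp add: compactin_subtopology)
    show "continuous_map (top_of_set (coord_img c)) (mtop M) (coord_inv c)"
      by (rule continuous_map_into_fulltopology[OF is_chart_continuous_coord_inv[OF ch]])
  qed
  have K_dom: "K \<subseteq> chart_dom c" using sub coord_inv_in[where c = c] by (auto simp: K_def)
  have fK: "?f ` K \<subseteq> chart_dom c" using r(2) by (auto simp: K_def rep_dom_def)
  have coordK: "coord c ` K = cball x0 r"
    using sub coord_coord_inv[where c = c] by (force simp: K_def)
  let ?N = "Cinf_nbhd M ?f c c K (length vs) (\<epsilon> / 2)"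
  have "openin (Cinf_topology M) ?N"
    unfolding Cinf_topology_def
  proof (rule topology_generated_by_Basis, rule CollectI, intro exI, rule conjI[OF refl])
    show "?f \<in> extensional (points M) \<and> smooth_map M M ?f \<and> c \<in> atlas M \<and> c \<in> atlas M \<and>
        compactin (mtop M) K \<and> K \<subseteq> chart_dom c \<and> ?f ` K \<subseteq> chart_dom c \<and> 0 < \<epsilon> / 2"
      using ext[OF s0] act_smooth[OF s0] c K_comp K_dom fK \<epsilon> by simp
  qed
  then have op: "openin (prod_topology (top_of_set {0..1}) euclideanreal)
      {q \<in> topspace (prod_topology (top_of_set {0..1}) euclideanreal). (case q of (s, t) \<Rightarrow> act s t) \<in> ?N}"
    by (rule openin_continuous_map_preimage[OF act_cont])
  have mem: "(s0, t0) \<in> {q \<in> topspace (prod_topology (top_of_set {0..1}) euclideanreal).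
      (case q of (s, t) \<Rightarrow> act s t) \<in> ?N}"
    using s0 ext[OF s0] act_smooth[OF s0] fK \<epsilon> by (simp add: Cinf_nbhd_def)
  from op[unfolded openin_prod_topology_alt, rule_format, OF mem]
  obtain U V where UV: "openin (top_of_set {0..1}) U" "open V" "s0 \<in> U" "t0 \<in> V"
      and sub_N: "U \<times> V \<subseteq> {q \<in> topspace (prod_topology (top_of_set {0..1}) euclideanreal).
        (case q of (s, t) \<Rightarrow> act s t) \<in> ?N}"
    by auto
  have UV_N: "act s t \<in> ?N" if "s \<in> U" "t \<in> V" for s t
    using subsetD[OF sub_N SigmaI[OF that]] by simp
  from UV(1) obtain U' where U': "open U'" "U = {0..1} \<inter> U'" by (auto simp: openin_open)
  let ?W = "(U' \<times> ball x0 (min r \<delta>1)) \<times> V"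
  \<comment> \<open>One half of \<open>\<epsilon>\<close> is for the change of the map, the other for the change of the point.\<close>
  have goal: "x \<in> rep_dom c s t \<and> norm (iter_deriv vs (rep c s t) x - iter_deriv vs (rep c s0 t0) x0) < \<epsilon>"
    if "((s, x), t) \<in> ?W" "s \<in> {0..1}" for s x t
  proof -
    have N: "act s t \<in> ?N" using that U' by (intro UV_N) auto
    have x: "x \<in> cball x0 r" "dist x x0 < \<delta>1" using that by (auto simp: dist_commute)
    have "coord_inv c x \<in> K" using x by (simp add: K_def)
    then have "x \<in> rep_dom c s t" using N sub x(1) by (auto simp: rep_dom_def Cinf_nbhd_def)
    moreover have "norm (iter_deriv vs (rep c s t) x - iter_deriv vs (rep c s0 t0) x) < \<epsilon> / 2"
      using N x(1) vs unfolding Cinf_nbhd_def rep_def coordK by blast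
    moreover have "norm (iter_deriv vs (rep c s0 t0) x - iter_deriv vs (rep c s0 t0) x0) < \<epsilon> / 2"
      using \<delta>1(2)[OF x(2)] by (simp add: dist_norm)
    ultimately show ?thesis
      using norm_diff_triangle_less[where ?e1.0 = "\<epsilon> / 2" and ?e2.0 = "\<epsilon> / 2"] by fastforce
  qed
  show ?thesis
    unfolding eventually_nhds
  proof (intro exI[of _ ?W] conjI)
    show "open ?W" using U' UV by (intro open_Times) auto
    show "((s0, x0), t0) \<in> ?W" using UV U' r \<delta>1 by auto
    show "\<forall>q \<in> ?W. case q of ((s, x), t) \<Rightarrow> s \<in> {0..1} \<longrightarrow> x \<in> rep_dom c s t \<and>
        norm (iter_deriv vs (rep c s t) x - iter_deriv vs (rep c s0 t0) x0) < \<epsilon>"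
      using goal by fast
  qed
qed

lemma act_periodic_int: "s \<in> {0..1} \<Longrightarrow> act s (t + of_int n) = act s t"
proof (induction n rule: int_induct[where k = 0])
  case (step1 n)
  then show ?case using act_periodic[of s "t + of_int n"] by (simp add: add.assoc)
next
  case (step2 n)
  then show ?case using act_periodic[of s "t + of_int (n - 1)"] by (simp add: add.assoc)
qed simp

lemma act_frac: "s \<in> {0..1} \<Longrightarrow> act s (frac t) = act s t"
  using act_periodic_int[of s "frac t" "\<lfloor>t\<rfloor>"] by (simp add: frac_def)

lemma frac_unit: "frac t \<in> {0..1}" for t :: real
  using frac_ge_0[of t] frac_lt_1[of t] by simp

lemma Fix_iff:
  assumes s: "s \<in> {0..1}"
  shows "p \<in> Fix s \<longleftrightarrow> p \<in> points M \<and> (\<forall>t \<in> {0..1}. act s t p = p)"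
proof
  assume p: "p \<in> points M \<and> (\<forall>t \<in> {0..1}. act s t p = p)"
  have "act s t p = p" for t using p frac_unit[of t] act_frac[OF s, of t] by metis
  then show "p \<in> Fix s" using p by (simp add: Fix_def)
qed (auto simp: Fix_def)

lemma rep_add:
  assumes "c \<in> atlas M" "s \<in> {0..1}" "x \<in> rep_dom c s u"
  shows "rep c s t (rep c s u x) = rep c s (t + u) x"
  using assms coord_inv_coord[OF atlas_chart[OF assms(1)]] act_add[OF assms(2) coord_inv_points[OF assms(1)]]
  by (simp add: rep_eq rep_dom_def)

lemma Fix_rep_dom:
  assumes "c \<in> atlas M" "p \<in> Fix s" "p \<in> chart_dom c"
  shows "coord c p \<in> rep_dom c s t" "rep c s t (coord c p) = coord c p"
  using assms coord_inv_coord[OF atlas_chart[OF assms(1)]]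
  by (auto simp: rep_dom_def Fix_def rep_eq coord_in)

end

section \<open>Rigidity near a fixed point\<close>

context action_homotopy
begin

context
  fixes c :: "('a, 'e) chart" and s0 :: real and p :: 'a and x0 :: 'e
  assumes c: "c \<in> atlas M" and s0: "s0 \<in> {0..1}" and p: "p \<in> Fix s0" "p \<in> chart_dom c"
    and x0: "x0 = coord c p"
begin

text \<open>The isotropy representation at the fixed point \<open>p\<close> in the chart \<open>c\<close>.\<close>

definition lin :: "real \<Rightarrow> 'e \<Rightarrow> 'e" where
  "lin t = frechet_derivative (rep c s0 t) (at x0)"

lemma x0_rep_dom: "x0 \<in> rep_dom c s0 t"
  using Fix_rep_dom(1)[OF c p] x0 by simp

lemma rep_x0: "rep c s0 t x0 = x0"
  using Fix_rep_dom(2)[OF c p] x0 by simp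

lemma lin_has_derivative: "(rep c s0 t has_derivative lin t) (at x0)"
  using diff_upto_imp_has_derivative x0_rep_dom[of t] rep_smooth[OF c s0, of t]
  unfolding smooth_on_iff_diff_upto lin_def by blast

lemma lin_linear: "linear (lin t)"
  using lin_has_derivative has_derivative_linear by blast

text \<open>Uniqueness of the derivative turns identities between the maps near \<open>x0\<close> into identities between
  the linearisations.\<close>

lemma lin_eqI:
  assumes "(h has_derivative h') (at x0)" "open S" "x0 \<in> S" "\<And>x. x \<in> S \<Longrightarrow> h x = rep c s0 t x"
  shows "lin t = h'"
  using has_derivative_unique[OF lin_has_derivative has_derivative_transform_within_open[OF assms]]
  by simp

lemma lin_add: "lin (t + u) v = lin t (lin u v)"
proof -
  have "lin (t + u) = (\<lambda>v. lin t (lin u v))"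
  proof (rule lin_eqI)
    show "((\<lambda>x. rep c s0 t (rep c s0 u x)) has_derivative (\<lambda>v. lin t (lin u v))) (at x0)"
      by (rule has_derivative_compose[OF lin_has_derivative]) (simp add: rep_x0 lin_has_derivative)
    show "open (rep_dom c s0 u)" by (rule smooth_on_open[OF rep_smooth[OF c s0]])
  qed (use x0_rep_dom rep_add[OF c s0] in auto)
  then show ?thesis by simp
qed

lemma lin_0: "lin 0 v = v"
proof -
  have "lin 0 = (\<lambda>v. v)"
  proof (rule lin_eqI)
    show "open (coord_img c)" using atlas_chart[OF c] by (simp add: is_chart_def)
    show "x0 \<in> coord_img c" using x0_rep_dom by (simp add: rep_dom_def)
    show "x = rep c s0 0 x" if "x \<in> coord_img c" for x
      unfolding rep_eq act_0[OF s0 coord_inv_points[OF c that]] using coord_coord_inv[OF that] by simp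
  qed auto
  then show ?thesis by simp
qed

lemma lin_periodic: "lin (t + 1) v = lin t v"
  unfolding lin_def rep_def act_periodic[OF s0] ..

text \<open>The matrix of \<open>lin t\<close> consists of first derivatives of \<^const>\<open>rep\<close>, so its continuity in \<open>t\<close> is a
  case of joint continuity.\<close>

lemma lin_expand: "lin t v = (\<Sum>b\<in>Basis. (v \<bullet> b) *\<^sub>R iter_deriv [b] (rep c s0 t) x0)"
  by (subst linear_basis_expansion[OF lin_linear]) (simp add: lin_def)

lemma rep_jointly_continuous_at:
  assumes "vs \<in> lists Basis" "s \<in> {0..1}" "x \<in> rep_dom c s t"
  shows "((\<lambda>(x, t). iter_deriv vs (rep c s t) x) \<longlongrightarrow> iter_deriv vs (rep c s t) x) (at (x, t))"
  unfolding tendsto_iff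
proof (intro allI impI)
  fix e :: real assume "e > 0"
  note ev = rep_jointly_continuous[OF c assms(2,3,1) this]
  have "((\<lambda>q. ((s, fst q), snd q)) \<longlongrightarrow> ((s, x), t)) (at (x, t))"
    by (auto intro!: tendsto_eq_intros)
  from eventually_compose_filterlim[OF ev this]
  show "\<forall>\<^sub>F q in at (x, t). dist (case q of (x, t) \<Rightarrow> iter_deriv vs (rep c s t) x)
      (iter_deriv vs (rep c s t) x) < e"
    by eventually_elim (use assms(2) in \<open>auto simp: dist_norm\<close>)
qed

lemma lin_cont: "continuous_on UNIV (\<lambda>t. lin t v)"
proof -
  have "isCont (\<lambda>t. iter_deriv [b] (rep c s0 t) x0) t" if "b \<in> Basis" for b t
  proof -
    have 1: "isCont (\<lambda>(x, t). iter_deriv [b] (rep c s0 t) x) (x0, t)"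
      using rep_jointly_continuous_at[OF _ s0 x0_rep_dom, of "[b]" t] that by (simp add: isCont_def)
    have "isCont (\<lambda>t. (x0, t)) t" by (intro continuous_intros)
    from isCont_o2[where g = "\<lambda>(x, t). iter_deriv [b] (rep c s0 t) x", OF this 1]
    show ?thesis by simp
  qed
  then show ?thesis
    unfolding lin_expand by (intro continuous_on_sum continuous_on_scaleR continuous_on_const)
      (simp add: continuous_at_imp_continuous_on)
qed

lemma lin_bounded: "\<exists>C \<ge> 1. \<forall>t \<in> {0..1}. \<forall>v. norm (lin (- t) v) \<le> C * norm v"
proof -
  have "continuous_on {0..1} (\<lambda>t. lin (- t) b)" for b
    by (rule continuous_on_compose2[OF lin_cont]) (auto intro: continuous_intros)
  then have "continuous_on {0..1} (\<lambda>t. \<Sum>b\<in>Basis. norm (lin (- t) b))"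
    by (intro continuous_intros)
  then have "bounded ((\<lambda>t. \<Sum>b\<in>Basis. norm (lin (- t) b)) ` {0..1})"
    by (intro compact_imp_bounded compact_continuous_image) auto
  then obtain K where K: "\<And>t. t \<in> {0..1} \<Longrightarrow> norm (\<Sum>b\<in>Basis. norm (lin (- t) b)) \<le> K"
    unfolding bounded_iff by blast
  have "norm (lin (- t) v) \<le> max K 1 * norm v" if "t \<in> {0..1}" for t v
  proof -
    have "norm (lin (- t) v) \<le> (\<Sum>b\<in>Basis. norm v * norm (lin (- t) b))"
      unfolding linear_basis_expansion[OF lin_linear, of "- t" v]
      by (rule order_trans[OF norm_sum]) (auto intro!: sum_mono mult_right_mono Basis_le_norm)
    also have "\<dots> = norm v * (\<Sum>b\<in>Basis. norm (lin (- t) b))" by (simp add: sum_distrib_left)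
    also have "\<dots> \<le> norm v * max K 1"
      using K[OF that] by (intro mult_left_mono) (auto simp: abs_le_iff)
    finally show ?thesis by (simp add: mult.commute)
  qed
  then show ?thesis by (intro exI[of _ "max K 1"]) auto
qed

text \<open>Closeness to the action at time \<open>s0\<close>, at the point \<open>x0\<close> and with the same group element, uniformly
  in the group element.\<close>

lemma rep_tube:
  assumes vs: "vs \<in> lists Basis" and "\<epsilon> > 0"
  shows "\<forall>\<^sub>F y in nhds (s0, x0). \<forall>t \<in> {0..1}. fst y \<in> {0..1} \<longrightarrow> snd y \<in> rep_dom c (fst y) t \<and>
     norm (iter_deriv vs (rep c (fst y) t) (snd y) - iter_deriv vs (rep c s0 t) x0) < \<epsilon>"
proof -
  define P where "P q \<longleftrightarrow> (fst (fst q) \<in> {0..1} \<longrightarrow> snd (fst q) \<in> rep_dom c (fst (fst q)) (snd q) \<and>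
     norm (iter_deriv vs (rep c (fst (fst q)) (snd q)) (snd (fst q)) -
       iter_deriv vs (rep c s0 (snd q)) x0) < \<epsilon>)" for q :: "(real \<times> 'e) \<times> real"
  have "\<forall>\<^sub>F q in nhds ((s0, x0), t). P q" for t
  proof -
    have "\<epsilon> / 2 > 0" using assms by simp
    note ev = rep_jointly_continuous[OF c s0 x0_rep_dom vs this, of t]
    have "((\<lambda>q. ((s0, x0), snd q)) \<longlongrightarrow> ((s0, x0), t)) (nhds ((s0, x0), t))"
      by (intro tendsto_Pair tendsto_const) (auto intro!: tendsto_eq_intros filterlim_ident)
    from ev eventually_compose_filterlim[OF ev this] show ?thesis
    proof eventually_elim
      case (elim q)
      obtain s x u where q: "q = ((s, x), u)" by (metis prod.exhaust)
      show ?case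
        using elim s0 norm_diff_triangle_less[where ?e1.0 = "\<epsilon> / 2" and ?e2.0 = "\<epsilon> / 2"]
        unfolding P_def q by (fastforce simp: norm_minus_commute)
    qed
  qed
  from eventually_nhds_tube[of "{0..1}", OF _ this]
  show ?thesis by (simp add: P_def)
qed

lemma rep_tube_x0:
  assumes "\<epsilon> > 0"
  obtains \<delta> where "\<delta> > 0" "\<And>s x t. s \<in> {0..1} \<Longrightarrow> dist s s0 < \<delta> \<Longrightarrow> dist x x0 < \<delta> \<Longrightarrow>
    t \<in> {0..1} \<Longrightarrow> norm (rep c s t x - x0) < \<epsilon>"
proof -
  have "[] \<in> lists (Basis :: 'e set)" by simp
  from eventually_nhds_pair_dist[OF rep_tube[OF this assms]]
  obtain \<delta> where \<delta>: "\<delta> > 0" "\<And>s x. dist s s0 < \<delta> \<Longrightarrow> dist x x0 < \<delta> \<Longrightarrow> \<forall>t \<in> {0..1}.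
      fst (s, x) \<in> {0..1} \<longrightarrow> snd (s, x) \<in> rep_dom c (fst (s, x)) t \<and>
      norm (iter_deriv [] (rep c (fst (s, x)) t) (snd (s, x)) - iter_deriv [] (rep c s0 t) x0) < \<epsilon>"
    by metis
  show thesis
  proof (rule that[OF \<delta>(1)])
    show "norm (rep c s t x - x0) < \<epsilon>"
      if "s \<in> {0..1}" "dist s s0 < \<delta>" "dist x x0 < \<delta>" "t \<in> {0..1}" for s x t
      using \<delta>(2)[OF that(2,3)] that by (simp add: rep_x0)
  qed
qed

text \<open>\<open>lin (- t) \<circ> rep c s t\<close> minus the identity has derivative \<open>lin (- t) (D (rep c s t) x - lin t)\<close>.
  Its norm is at most \<open>C * DIM('e) * \<epsilon>\<close>, so by the mean value theorem the hypothesis \<open>small\<close> gives the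
  Lipschitz constant \<open>1 / 2\<close>.\<close>

lemma averaging_rep:
  assumes s: "s \<in> {0..1}"
    and dom: "\<And>t x. t \<in> {0..1} \<Longrightarrow> x \<in> ball x0 \<delta> \<Longrightarrow> x \<in> rep_dom c s t"
    and close: "\<And>t x b. t \<in> {0..1} \<Longrightarrow> x \<in> ball x0 \<delta> \<Longrightarrow> b \<in> Basis \<Longrightarrow>
      norm (iter_deriv [b] (rep c s t) x - iter_deriv [b] (rep c s0 t) x0) \<le> \<epsilon>"
    and C: "\<And>t v. t \<in> {0..1} \<Longrightarrow> norm (lin (- t) v) \<le> C * norm v" "C \<ge> 0"
    and small: "C * DIM('e) * \<epsilon> \<le> 1 / 2"
  shows "averaging (ball x0 \<delta>) (rep c s) lin"
proof
  have dom': "ball x0 \<delta> \<subseteq> rep_dom c s t" for t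
    using dom[OF frac_unit[of t]] act_frac[OF s, of t] by (auto simp: rep_dom_def)
  show smooth: "smooth_on (ball x0 \<delta>) (rep c s t)" for t
    by (rule smooth_on_subset[OF rep_smooth[OF c s] open_ball dom'])
  show "continuous_on (ball x0 \<delta> \<times> UNIV) (\<lambda>(x, t). iter_deriv vs (rep c s t) x)"
    if "vs \<in> lists Basis" for vs
    using rep_jointly_continuous_at[OF that s] dom'
    by (intro continuous_at_imp_continuous_on) (auto simp: isCont_def)
  show "rep c s (t + 1) = rep c s t" for t
    unfolding rep_def act_periodic[OF s] ..
  show "norm (lin (- t) (rep c s t x - rep c s t y) - (x - y)) \<le> norm (x - y) / 2"
    if xy: "x \<in> ball x0 \<delta>" "y \<in> ball x0 \<delta>" and t: "t \<in> {0..1}" for t x y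
  proof -
    define h where "h = (\<lambda>x. lin (- t) (rep c s t x) - x)"
    define h' where "h' = (\<lambda>x v. lin (- t) (\<Sum>b\<in>Basis. (v \<bullet> b) *\<^sub>R iter_deriv [b] (rep c s t) x) - v)"
    have "(h has_derivative h' x) (at x within ball x0 \<delta>)" if "x \<in> ball x0 \<delta>" for x
    proof -
      have D: "(rep c s t has_derivative
          (\<lambda>v. \<Sum>b\<in>Basis. (v \<bullet> b) *\<^sub>R iter_deriv [b] (rep c s t) x)) (at x)"
        using smooth_on_iter_deriv_has_derivative[OF smooth[of t] _ that, of "[]"] by simp
      note bl = lin_linear[of "- t", unfolded linear_conv_bounded_linear]
      show ?thesis
        unfolding h_def h'_def
        by (rule has_derivative_at_withinI[OF has_derivative_diff[OF
              bounded_linear.has_derivative[OF bl D] has_derivative_ident]])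
    qed
    moreover have "onorm (h' x) \<le> 1 / 2" if x: "x \<in> ball x0 \<delta>" for x
    proof (rule onorm_bound)
      fix v
      have v: "lin (- t) (lin t v) = v" using lin_add[of "- t" t v] lin_0 by simp
      have "(\<Sum>b\<in>Basis. (v \<bullet> b) *\<^sub>R
          (iter_deriv [b] (rep c s t) x - iter_deriv [b] (rep c s0 t) x0)) =
          (\<Sum>b\<in>Basis. (v \<bullet> b) *\<^sub>R iter_deriv [b] (rep c s t) x) - lin t v"
        by (simp only: lin_expand[of t v] scaleR_diff_right sum_subtractf)
      then have diff: "lin (- t) (\<Sum>b\<in>Basis. (v \<bullet> b) *\<^sub>R
          (iter_deriv [b] (rep c s t) x - iter_deriv [b] (rep c s0 t) x0)) = h' x v"
        by (simp only: h'_def linear_diff[OF lin_linear] v)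
      have "norm (\<Sum>b\<in>Basis. (v \<bullet> b) *\<^sub>R
          (iter_deriv [b] (rep c s t) x - iter_deriv [b] (rep c s0 t) x0)) \<le>
          (\<Sum>b\<in>(Basis :: 'e set). norm v * \<epsilon>)"
        using close[OF t x]
        by (intro order_trans[OF norm_sum] sum_mono) (auto intro!: mult_mono Basis_le_norm)
      then have "norm (h' x v) \<le> C * (\<Sum>b\<in>(Basis :: 'e set). norm v * \<epsilon>)"
        unfolding diff[symmetric] using C(2) by (intro order_trans[OF C(1)[OF t]] mult_left_mono)
      moreover have "C * DIM('e) * \<epsilon> * norm v \<le> 1 / 2 * norm v"
        using small by (intro mult_right_mono) auto
      ultimately show "norm (h' x v) \<le> 1 / 2 * norm v" by (simp add: algebra_simps)
    qed simp
    ultimately have "norm (h x - h y) \<le> 1 / 2 * norm (x - y)"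
      using differentiable_bound[of "ball x0 \<delta>" h h' "1 / 2" x y] xy by simp
    then show ?thesis by (simp add: h_def linear_diff[OF lin_linear] algebra_simps)
  qed
qed (use lin_linear lin_add lin_0 lin_periodic lin_cont linear_add[OF lin_linear]
    linear_scale[OF lin_linear] in auto)

text \<open>Inside the chart being fixed means that the coordinates are fixed; the rest is
  \<open>fixed_iff_average_invariant\<close>.\<close>

lemma Fix_iff_average_invariant:
  assumes av: "averaging B (rep c s) lin" and s: "s \<in> {0..1}" and x: "x \<in> B"
    and dom: "\<And>t. t \<in> {0..1} \<Longrightarrow> x \<in> rep_dom c s t"
    and orbit: "\<And>t. t \<in> {0..1} \<Longrightarrow> rep c s t x \<in> B"
  shows "coord_inv c x \<in> Fix s \<longleftrightarrow> averaging.average (rep c s) lin x \<in> averaging.invariant_vectors lin"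
proof -
  interpret averaging B "rep c s" lin by (rule av)
  have dom': "x \<in> rep_dom c s t" for t
    using dom[OF frac_unit[of t]] act_frac[OF s, of t] by (simp add: rep_dom_def)
  have img: "x \<in> coord_img c" using dom'[of 0] by (simp add: rep_dom_def)
  have "coord_inv c x \<in> Fix s \<longleftrightarrow> (\<forall>t \<in> {0..1}. rep c s t x = x)"
  proof
    assume "coord_inv c x \<in> Fix s"
    from Fix_rep_dom(2)[OF c this coord_inv_in[OF img]]
    show "\<forall>t \<in> {0..1}. rep c s t x = x" by (simp add: coord_coord_inv[OF img])
  next
    assume fixed: "\<forall>t \<in> {0..1}. rep c s t x = x"
    have "act s t (coord_inv c x) = coord_inv c x" if "t \<in> {0..1}" for t
    proof -
      have "act s t (coord_inv c x) \<in> chart_dom c" using dom' by (simp add: rep_dom_def)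
      from coord_inv_coord[OF atlas_chart[OF c] this] show ?thesis
        using fixed that by (simp add: rep_eq)
    qed
    then show "coord_inv c x \<in> Fix s"
      unfolding Fix_iff[OF s] using coord_inv_points[OF c img] by blast
  qed
  also have "\<dots> \<longleftrightarrow> average x \<in> invariant_vectors"
    by (rule fixed_iff_average_invariant[OF x orbit]) (simp_all add: rep_add[OF c s dom'])
  finally show ?thesis .
qed

text \<open>In the coordinates \<open>average \<circ> coord c\<close> the fixed point set is the subspace of invariant vectors.
  The chart is cut down so that its image is a ball, hence convex.\<close>

lemma Fix_locally_flat:
  assumes av: "averaging B (rep c s) lin" and s: "s \<in> {0..1}"
    and B': "open B'" "B' \<subseteq> B"
    and dom: "\<And>t x. t \<in> {0..1} \<Longrightarrow> x \<in> B' \<Longrightarrow> x \<in> rep_dom c s t"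
    and orbit: "\<And>t x. t \<in> {0..1} \<Longrightarrow> x \<in> B' \<Longrightarrow> rep c s t x \<in> B"
    and q: "q \<in> Fix s" "q \<in> chart_dom c" "coord c q \<in> B'"
  shows "locally_flat_at M (dim (averaging.invariant_vectors lin)) (Fix s) q"
proof -
  interpret averaging B "rep c s" lin by (rule av)
  have iff: "coord_inv c x \<in> Fix s \<longleftrightarrow> average x \<in> invariant_vectors" if "x \<in> B'" for x
    by (rule Fix_iff_average_invariant[OF av s]) (use that B' dom orbit in auto)
  have inv: "coord_inv c (coord c q') = q'" if "q' \<in> chart_dom c" for q'
    by (rule coord_inv_coord[OF atlas_chart[OF c] that])
  have B'_img: "B' \<subseteq> coord_img c" using dom[of 0] by (auto simp: rep_dom_def)
  have "open (average ` B')"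
    by (rule near_id_on_open_image[OF near_id_on_subset[OF near_id_average B'(2)] B'(1)])
  moreover have "average (coord c q) \<in> average ` B'" using q by blast
  ultimately obtain r where r: "r > 0" "ball (average (coord c q)) r \<subseteq> average ` B'"
    using openE by blast
  define W where "W = {x \<in> B'. average x \<in> ball (average (coord c q)) r}"
  have W: "open W"
  proof -
    have "continuous_on B' average"
      by (rule continuous_on_subset[OF near_id_on_continuous[OF near_id_average] B'(2)])
    then have "open (B' \<inter> average -` ball (average (coord c q)) r)"
      using continuous_open_preimage B'(1) by blast
    moreover have "B' \<inter> average -` ball (average (coord c q)) r = W" by (auto simp: W_def)
    ultimately show ?thesis by simp
  qed
  have W_sub: "W \<subseteq> B'" by (auto simp: W_def)
  have W_img: "average ` W = ball (average (coord c q)) r" using r(2) by (auto simp: W_def)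
  define c' where "c' = ({q' \<in> chart_dom c. coord c q' \<in> W}, average \<circ> coord c)"
  note def = chart_deformation[OF _ atlas_chart[OF c] atlas_compatible[OF c] near_id_average
      smooth_average W order_trans[OF W_sub B'(2)] order_trans[OF W_sub B'_img], folded c'_def]
  have img: "coord_img c' = ball (average (coord c q)) r"
    using def(3) atlas_chart W_img by simp
  have "coord c' ` (chart_dom c' \<inter> Fix s) = coord_img c' \<inter> invariant_vectors"
  proof (intro equalityI subsetI)
    fix y assume "y \<in> coord c' ` (chart_dom c' \<inter> Fix s)"
    then obtain q' where q': "q' \<in> chart_dom c'" "q' \<in> Fix s" "y = coord c' q'" by blast
    then have "q' \<in> chart_dom c" "coord c q' \<in> B'" "y = average (coord c q')"
      using W_sub by (auto simp: c'_def)
    then show "y \<in> coord_img c' \<inter> invariant_vectors"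
      using iff[of "coord c q'"] inv q' coord_in[of q' c'] by simp
  next
    fix y assume y: "y \<in> coord_img c' \<inter> invariant_vectors"
    then obtain x where x: "x \<in> W" "y = average x" using img W_img by blast
    then have xi: "x \<in> coord_img c" and xB: "x \<in> B'" using W_sub B'_img by auto
    have "coord_inv c x \<in> Fix s" using iff[OF xB] y x(2) by simp
    moreover have "coord_inv c x \<in> chart_dom c'" "coord c' (coord_inv c x) = y"
      using x coord_inv_in[OF xi] coord_coord_inv[OF xi] by (simp_all add: c'_def)
    ultimately show "y \<in> coord c' ` (chart_dom c' \<inter> Fix s)" by (metis IntI imageI)
  qed
  then have "slice_chart M (dim invariant_vectors) (Fix s) c'"
    unfolding slice_chart_def using def(1,2) atlas_chart subspace_invariant_vectors by blast
  moreover have "q \<in> chart_dom c'"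
    using q r(1) by (simp add: c'_def W_def)
  ultimately show ?thesis
    unfolding locally_flat_at_def using img convex_ball by metis
qed

text \<open>Three radii are chosen: on the ball of radius \<open>\<delta>1\<close> the averages of all nearby actions are
  perturbations of the identity; orbits of points of the ball of radius \<open>\<delta>2\<close> stay in the first ball;
  and for times within \<open>\<delta>3\<close> of \<open>s0\<close> the value of the average at \<open>x0\<close> changes so little that the
  value at time \<open>s0\<close>, an invariant vector, is still attained on the second ball.  A point mapped to that vector is
  a fixed point, so fixed points do not disappear.  The dimension is that of the invariant vectors of
  \<open>lin\<close>, which belongs to time \<open>s0\<close> and does not depend on the nearby time.\<close>

lemma Fix_near_fixed_point:
  obtains d \<delta> U where "\<delta> > 0" "openin (mtop M) U" "p \<in> U"
    "\<And>s. s \<in> {0..1} \<Longrightarrow> dist s s0 < \<delta> \<Longrightarrow> Fix s \<inter> U \<noteq> {}"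
    "\<And>s q. s \<in> {0..1} \<Longrightarrow> dist s s0 < \<delta> \<Longrightarrow> q \<in> Fix s \<inter> U \<Longrightarrow> locally_flat_at M d (Fix s) q"
proof -
  obtain C where C: "C \<ge> 1" "\<And>t v. t \<in> {0..1} \<Longrightarrow> norm (lin (- t) v) \<le> C * norm v"
    using lin_bounded by blast
  define \<epsilon> where "\<epsilon> = 1 / (2 * C * DIM('e))"
  have \<epsilon>: "\<epsilon> > 0" "C * DIM('e) * \<epsilon> \<le> 1 / 2" using C(1) by (auto simp: \<epsilon>_def)
  have "\<forall>\<^sub>F y in nhds (s0, x0). \<forall>b \<in> Basis. \<forall>t \<in> {0..1}. fst y \<in> {0..1} \<longrightarrow>
      snd y \<in> rep_dom c (fst y) t \<and>
      norm (iter_deriv [b] (rep c (fst y) t) (snd y) - iter_deriv [b] (rep c s0 t) x0) < \<epsilon>"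
    using \<epsilon> by (intro eventually_ball_finite finite_Basis ballI rep_tube) auto
  from eventually_nhds_pair_dist[OF this]
  obtain \<delta>1 where "\<delta>1 > 0" and \<delta>1: "\<And>s x t b. s \<in> {0..1} \<Longrightarrow> dist s s0 < \<delta>1 \<Longrightarrow> dist x x0 < \<delta>1 \<Longrightarrow>
      t \<in> {0..1} \<Longrightarrow> b \<in> Basis \<Longrightarrow> x \<in> rep_dom c s t \<and>
      norm (iter_deriv [b] (rep c s t) x - iter_deriv [b] (rep c s0 t) x0) < \<epsilon>"
    by (metis fst_conv snd_conv)
  obtain b :: 'e where b: "b \<in> Basis" using nonempty_Basis by blast
  from rep_tube_x0[OF \<open>\<delta>1 > 0\<close>]
  obtain \<delta>2' where "\<delta>2' > 0" and \<delta>2': "\<And>s x t. s \<in> {0..1} \<Longrightarrow> dist s s0 < \<delta>2' \<Longrightarrow> dist x x0 < \<delta>2' \<Longrightarrow>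
      t \<in> {0..1} \<Longrightarrow> norm (rep c s t x - x0) < \<delta>1"
    by blast
  define \<delta>2 where "\<delta>2 = min \<delta>1 \<delta>2'"
  have \<delta>2: "\<delta>2 > 0" "\<delta>2 \<le> \<delta>1" "\<delta>2 \<le> \<delta>2'" using \<open>\<delta>1 > 0\<close> \<open>\<delta>2' > 0\<close> by (auto simp: \<delta>2_def)
  have "\<delta>2 / (4 * C) > 0" using \<delta>2 C by simp
  from rep_tube_x0[OF this]
  obtain \<delta>3 where "\<delta>3 > 0" and \<delta>3: "\<And>s t. s \<in> {0..1} \<Longrightarrow> dist s s0 < \<delta>3 \<Longrightarrow>
      t \<in> {0..1} \<Longrightarrow> norm (rep c s t x0 - x0) < \<delta>2 / (4 * C)"
    by (metis dist_self)
  define \<delta> where "\<delta> = min \<delta>2 \<delta>3"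
  define U where "U = {q \<in> chart_dom c. coord c q \<in> ball x0 \<delta>2}"
  have av: "averaging (ball x0 \<delta>1) (rep c s) lin" if "s \<in> {0..1}" "dist s s0 < \<delta>2" for s
  proof (rule averaging_rep[where C = C and \<epsilon> = \<epsilon>])
    show "x \<in> rep_dom c s t" if "t \<in> {0..1}" "x \<in> ball x0 \<delta>1" for t x
      using \<delta>1[of s x t b] that \<open>s \<in> {0..1}\<close> \<open>dist s s0 < \<delta>2\<close> \<delta>2 b by (simp add: dist_commute)
    show "norm (iter_deriv [b] (rep c s t) x - iter_deriv [b] (rep c s0 t) x0) \<le> \<epsilon>"
      if "t \<in> {0..1}" "x \<in> ball x0 \<delta>1" "b \<in> Basis" for t x b
      using \<delta>1[of s x t b] that \<open>s \<in> {0..1}\<close> \<open>dist s s0 < \<delta>2\<close> \<delta>2 by (simp add: dist_commute)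
  qed (use that C \<epsilon> in auto)
  have dom: "x \<in> rep_dom c s t"
    if "s \<in> {0..1}" "dist s s0 < \<delta>2" "t \<in> {0..1}" "x \<in> ball x0 \<delta>2" for s t x
    using \<delta>1[of s x t b] that \<delta>2 b by (simp add: dist_commute)
  have orbit: "rep c s t x \<in> ball x0 \<delta>1"
    if "s \<in> {0..1}" "dist s s0 < \<delta>2" "t \<in> {0..1}" "x \<in> ball x0 \<delta>2" for s t x
  proof -
    have "norm (rep c s t x - x0) < \<delta>1" using \<delta>2'[of s x t] that \<delta>2 by (simp add: dist_commute)
    then show ?thesis by (simp add: dist_norm norm_minus_commute)
  qed
  show thesis
  proof (rule that)
    show "\<delta> > 0" using \<delta>2 \<open>\<delta>3 > 0\<close> by (simp add: \<delta>_def)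
    show "openin (mtop M) U"
      unfolding U_def by (rule is_chart_open_preimage[OF atlas_chart[OF c] open_ball])
    show "p \<in> U" using p x0 \<delta>2 by (simp add: U_def)
    show "locally_flat_at M (dim (averaging.invariant_vectors lin)) (Fix s) q"
      if "s \<in> {0..1}" "dist s s0 < \<delta>" "q \<in> Fix s \<inter> U" for s q
    proof -
      have s: "dist s s0 < \<delta>2" using that by (simp add: \<delta>_def)
      show ?thesis
        by (rule Fix_locally_flat[OF av[OF that(1) s] that(1) open_ball _ dom[OF that(1) s] orbit[OF that(1) s]])
           (use that(3) \<delta>2(2) in \<open>auto simp: U_def\<close>)
    qed
    show "Fix s \<inter> U \<noteq> {}" if s: "s \<in> {0..1}" "dist s s0 < \<delta>" for s
    proof -
      have s': "dist s s0 < \<delta>2" "dist s s0 < \<delta>3" using s by (auto simp: \<delta>_def)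
      interpret A0: averaging "ball x0 \<delta>1" "rep c s0" lin by (rule av) (use s0 \<delta>2 in auto)
      interpret A: averaging "ball x0 \<delta>1" "rep c s" lin by (rule av[OF s(1) s'(1)])
      have x0_ball: "x0 \<in> ball x0 \<delta>2" "x0 \<in> ball x0 \<delta>1" using \<delta>2 by auto
      have inv0: "A0.average x0 \<in> A0.invariant_vectors"
        using A0.fixed_iff_average_invariant[OF x0_ball(2)] rep_x0 x0_ball by simp
      have int0: "(\<lambda>t. lin (- t) (rep c s0 t x0)) integrable_on {0..1}"
        using A0.integrand_integrable[of "[]" x0] x0_ball by simp
      have int: "(\<lambda>t. lin (- t) (rep c s t x0)) integrable_on {0..1}"
        using A.integrand_integrable[of "[]" x0] x0_ball by simp
      have "A0.average x0 - A.average x0 =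
          integral {0..1} (\<lambda>t. lin (- t) (rep c s0 t x0) - lin (- t) (rep c s t x0))"
        unfolding A0.average_def A.average_def
        by (rule Henstock_Kurzweil_Integration.integral_diff[OF int0 int, symmetric])
      moreover have "norm (integral {0..1} (\<lambda>t. lin (- t) (rep c s0 t x0) - lin (- t) (rep c s t x0)))
          \<le> \<delta>2 / 4 * (1 - 0)"
      proof (rule integral_bound)
        show "continuous_on {0..1} (\<lambda>t. lin (- t) (rep c s0 t x0) - lin (- t) (rep c s t x0))"
          using A0.integrand_cont_line[of "[]" x0] A.integrand_cont_line[of "[]" x0] x0_ball
          by (auto intro!: continuous_on_diff intro: continuous_on_subset)
        fix t :: real assume t: "t \<in> {0..1}"
        have "norm (lin (- t) (rep c s0 t x0) - lin (- t) (rep c s t x0)) =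
            norm (lin (- t) (rep c s0 t x0 - rep c s t x0))"
          by (simp add: linear_diff[OF lin_linear])
        also have "\<dots> \<le> C * norm (rep c s0 t x0 - rep c s t x0)" by (rule C(2)[OF t])
        also have "\<dots> \<le> C * (\<delta>2 / (4 * C))"
          using \<delta>3[OF s(1) s'(2) t] C(1) by (intro mult_left_mono) (simp_all add: rep_x0 norm_minus_commute)
        also have "\<dots> = \<delta>2 / 4" using C(1) by simp
        finally show "norm (lin (- t) (rep c s0 t x0) - lin (- t) (rep c s t x0)) \<le> \<delta>2 / 4" .
      qed simp
      ultimately have "norm (A0.average x0 - A.average x0) \<le> \<delta>2 / 2 / 2" by simp
      moreover have "cball x0 (\<delta>2 / 2) \<subseteq> ball x0 \<delta>1" using \<delta>2 by auto
      ultimately obtain z where z: "z \<in> cball x0 (\<delta>2 / 2)" "A.average z = A0.average x0"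
        using near_id_on_surj[OF A.near_id_average] by blast
      have zB: "z \<in> ball x0 \<delta>2" using z(1) \<delta>2 by auto
      have zB1: "z \<in> ball x0 \<delta>1" using zB \<delta>2 by auto
      have "coord_inv c z \<in> Fix s"
        using Fix_iff_average_invariant[OF av[OF s(1) s'(1)] s(1) zB1] dom[OF s(1) s'(1) _ zB]
          orbit[OF s(1) s'(1) _ zB] z(2) inv0 by simp
      moreover have "z \<in> coord_img c" using dom[OF s(1) s'(1) _ zB, of 0] by (simp add: rep_dom_def)
      then have "coord_inv c z \<in> U" using zB coord_inv_in[of z c] coord_coord_inv[of z c] by (simp add: U_def)
      ultimately show ?thesis by blast
    qed
  qed
qed

end

end

section \<open>Constancy of the type along a homotopy\<close>

lemma locally_flat_at_unique:
  assumes "locally_flat_at M d S q" "locally_flat_at M d' S q" "q \<in> S"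
  shows "d = d'"
proof -
  obtain c c' where "slice_chart M d S c" "q \<in> chart_dom c" "slice_chart M d' S c'" "q \<in> chart_dom c'"
    using assms(1,2) unfolding locally_flat_at_def by blast
  then show ?thesis by (meson slice_chart_dim_unique assms(3))
qed

context action_homotopy
begin

lemma Fix_subset: "Fix s \<subseteq> points M"
  by (auto simp: Fix_def)

lemma obtain_chart:
  assumes "p \<in> points M"
  obtains c where "c \<in> atlas M" "p \<in> chart_dom c"
  using assms manifold unfolding smooth_manifold_def by blast

lemma fixed_neighbourhood:
  assumes s0: "s0 \<in> {0..1}" and p: "p \<in> Fix s0"
  obtains d \<delta> U where "\<delta> > 0" "openin (mtop M) U" "p \<in> U"
    "\<And>s. s \<in> {0..1} \<Longrightarrow> dist s s0 < \<delta> \<Longrightarrow> Fix s \<inter> U \<noteq> {}"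
    "\<And>s q. s \<in> {0..1} \<Longrightarrow> dist s s0 < \<delta> \<Longrightarrow> q \<in> Fix s \<inter> U \<Longrightarrow> locally_flat_at M d (Fix s) q"
proof -
  obtain c where "c \<in> atlas M" "p \<in> chart_dom c" using obtain_chart p Fix_subset by blast
  from Fix_near_fixed_point[OF this(1) s0 p this(2) refl] that show thesis by metis
qed

lemma act_multiple: "s \<in> {0..1} \<Longrightarrow> p \<in> points M \<Longrightarrow> act s t p = p \<Longrightarrow> act s (of_nat n * t) p = p"
proof (induction n)
  case (Suc n)
  have "act s (of_nat (Suc n) * t) p = act s (t + of_nat n * t) p" by (simp add: algebra_simps)
  also have "\<dots> = p" using Suc act_add[OF Suc.prems(1,2), of t "of_nat n * t"] by simp
  finally show ?case .
qed (simp add: act_0)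

text \<open>A point that is not fixed is moved by arbitrarily small group elements, since the multiples of a
  small element exhaust the circle.  So it is moved within its chart, and this persists for nearby
  points and times.\<close>

lemma nonfixed_neighbourhood:
  assumes s0: "s0 \<in> {0..1}" and p: "p \<in> points M" "p \<notin> Fix s0"
  obtains \<delta> U where "\<delta> > 0" "openin (mtop M) U" "p \<in> U"
    "\<And>s. s \<in> {0..1} \<Longrightarrow> dist s s0 < \<delta> \<Longrightarrow> Fix s \<inter> U = {}"
proof -
  obtain c where c: "c \<in> atlas M" "p \<in> chart_dom c" using obtain_chart p by blast
  define x0 where "x0 = coord c p"
  have inv: "coord_inv c (coord c q) = q" if "q \<in> chart_dom c" for q
    by (rule coord_inv_coord[OF atlas_chart[OF c(1)] that])
  have "x0 \<in> rep_dom c s0 0"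
    using c inv act_0[OF s0 p(1)] by (simp add: rep_dom_def x0_def coord_in)
  from rep_jointly_continuous[OF c(1) s0 this, of "[]" 1]
  have "\<forall>\<^sub>F q in nhds ((s0, x0), 0). fst (fst q) \<in> {0..1} \<longrightarrow>
      snd (fst q) \<in> rep_dom c (fst (fst q)) (snd q)"
    by (simp add: case_prod_unfold eventually_mono)
  from eventually_nhds_pair_dist[OF this]
  obtain \<eta> where "\<eta> > 0" and \<eta>': "\<And>y t. dist y (s0, x0) < \<eta> \<Longrightarrow> dist t 0 < \<eta> \<Longrightarrow>
      fst (fst (y, t)) \<in> {0..1} \<longrightarrow> snd (fst (y, t)) \<in> rep_dom c (fst (fst (y, t))) (snd (y, t))"
    by blast
  have \<eta>: "\<eta> > 0" "\<And>t. dist t 0 < \<eta> \<Longrightarrow> x0 \<in> rep_dom c s0 t"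
    using \<open>\<eta> > 0\<close> \<eta>'[of "(s0, x0)"] s0 by simp_all
  have "\<exists>t. dist t 0 < \<eta> \<and> act s0 t p \<noteq> p"
  proof (rule ccontr)
    assume neg: "\<not> ?thesis"
    have "act s0 t p = p" for t
    proof -
      obtain n where n: "\<bar>t\<bar> < of_nat n * \<eta>" using \<eta>(1) reals_Archimedean3 by blast
      then have "n \<noteq> 0" by (intro notI) simp
      then have "dist (t / of_nat n) 0 < \<eta>" using n by (simp add: field_simps)
      then have "act s0 (t / of_nat n) p = p" using neg by blast
      from act_multiple[OF s0 p(1) this, of n] show ?thesis using \<open>n \<noteq> 0\<close> by simp
    qed
    then show False using p by (simp add: Fix_def)
  qed
  then obtain t where t: "x0 \<in> rep_dom c s0 t" "act s0 t p \<noteq> p" using \<eta> by blast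
  define e where "e = norm (rep c s0 t x0 - x0) / 2"
  have "rep c s0 t x0 \<noteq> x0"
  proof
    assume "rep c s0 t x0 = x0"
    moreover have "act s0 t p \<in> chart_dom c" using t(1) inv c by (simp add: rep_dom_def x0_def)
    ultimately show False using t(2) inv c by (metis rep_eq x0_def)
  qed
  then have "e > 0" by (simp add: e_def)
  have nil: "[] \<in> lists (Basis :: 'e set)" by simp
  have "\<forall>\<^sub>F q in nhds ((s0, x0), t). fst (fst q) \<in> {0..1} \<longrightarrow>
      norm (rep c (fst (fst q)) (snd q) (snd (fst q)) - rep c s0 t x0) < e"
    using rep_jointly_continuous[OF c(1) s0 t(1) nil \<open>e > 0\<close>]
    by eventually_elim (auto simp: case_prod_unfold)
  from eventually_nhds_pair_dist[OF this]
  obtain \<delta>' where \<delta>': "\<delta>' > 0" "\<And>y. dist y (s0, x0) < \<delta>' \<Longrightarrow> fst y \<in> {0..1} \<Longrightarrow>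
      norm (rep c (fst y) t (snd y) - rep c s0 t x0) < e"
    by (metis dist_self fst_conv snd_conv)
  have "\<forall>\<^sub>F y in nhds (s0, x0). fst y \<in> {0..1} \<longrightarrow>
      norm (rep c (fst y) t (snd y) - rep c s0 t x0) < e"
    unfolding eventually_nhds_metric using \<delta>' by blast
  from eventually_nhds_pair_dist[OF this]
  obtain \<delta> where \<delta>: "\<delta> > 0" "\<And>s x. dist s s0 < \<delta> \<Longrightarrow> dist x x0 < \<delta> \<Longrightarrow> s \<in> {0..1} \<Longrightarrow>
      norm (rep c s t x - rep c s0 t x0) < e"
    by (metis fst_conv snd_conv)
  define U where "U = {q \<in> chart_dom c. coord c q \<in> ball x0 (min \<delta> e)}"
  show thesis
  proof (rule that[OF \<delta>(1)])
    show "openin (mtop M) U"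
      unfolding U_def by (rule is_chart_open_preimage[OF atlas_chart[OF c(1)] open_ball])
    show "p \<in> U" using c \<delta>(1) \<open>e > 0\<close> by (simp add: U_def x0_def)
    show "Fix s \<inter> U = {}" if s: "s \<in> {0..1}" "dist s s0 < \<delta>" for s
    proof (rule ccontr)
      assume "Fix s \<inter> U \<noteq> {}"
      then obtain q where q: "q \<in> Fix s" "q \<in> chart_dom c" "dist (coord c q) x0 < \<delta>"
          "dist (coord c q) x0 < e"
        by (auto simp: U_def dist_commute)
      have "norm (coord c q - rep c s0 t x0) < e"
        using \<delta>(2)[OF s(2) q(3) s(1)] Fix_rep_dom(2)[OF c(1) q(1,2)] by simp
      moreover have "norm (coord c q - x0) < e" using q(4) by (simp add: dist_norm)
      ultimately have "norm (rep c s0 t x0 - x0) < e + e"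
        using norm_diff_triangle_less[of "rep c s0 t x0" "coord c q" e x0 e]
        by (simp add: norm_minus_commute)
      then show False by (simp add: e_def)
    qed
  qed
qed

definition flat_times :: "nat \<Rightarrow> real set" where
  "flat_times d = {s \<in> {0..1}. \<exists>p \<in> Fix s. locally_flat_at M d (Fix s) p}"

lemma open_flat_times: "openin (top_of_set {0..1}) (flat_times d)"
  unfolding openin_euclidean_subtopology_iff
proof (intro conjI ballI)
  fix s0 assume "s0 \<in> flat_times d"
  then obtain p where s0: "s0 \<in> {0..1}" and p: "p \<in> Fix s0" "locally_flat_at M d (Fix s0) p"
    by (auto simp: flat_times_def)
  obtain d' \<delta> U where \<delta>: "\<delta> > 0" "p \<in> U"
      and ne: "\<And>s. s \<in> {0..1} \<Longrightarrow> dist s s0 < \<delta> \<Longrightarrow> Fix s \<inter> U \<noteq> {}"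
      and flat: "\<And>s q. s \<in> {0..1} \<Longrightarrow> dist s s0 < \<delta> \<Longrightarrow> q \<in> Fix s \<inter> U \<Longrightarrow> locally_flat_at M d' (Fix s) q"
    using fixed_neighbourhood[OF s0 p(1)] by metis
  have "d' = d" using locally_flat_at_unique[OF flat[OF s0] p(2) p(1)] \<delta> p(1) by simp
  have "s \<in> flat_times d" if "s \<in> {0..1}" "dist s s0 < \<delta>" for s
    using ne[OF that] flat[OF that] that \<open>d' = d\<close> unfolding flat_times_def by blast
  then show "\<exists>e>0. \<forall>s\<in>{0..1}. dist s s0 < e \<longrightarrow> s \<in> flat_times d" using \<delta>(1) by blast
qed (auto simp: flat_times_def)

text \<open>If dimension \<open>d\<close> does not occur at time \<open>s0\<close>, then every point has a neighbourhood in which it does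
  not occur at nearby times, because the point is moved or because the dimension near it is another
  one.  Finitely many of these neighbourhoods cover the manifold.\<close>

lemma closed_flat_times:
  assumes "compact_space (mtop M)"
  shows "closedin (top_of_set {0..1}) (flat_times d)"
proof -
  have "openin (top_of_set {0..1}) ({0..1} - flat_times d)"
    unfolding openin_euclidean_subtopology_iff
  proof (intro conjI ballI)
    fix s0 assume s0': "s0 \<in> {0..1} - flat_times d"
    then have s0: "s0 \<in> {0..1}" by simp
    have "\<exists>U \<delta>. openin (mtop M) U \<and> p \<in> U \<and> \<delta> > 0 \<and> (\<forall>s \<in> {0..1}. dist s s0 < \<delta> \<longrightarrow>
        (\<forall>q \<in> Fix s \<inter> U. \<not> locally_flat_at M d (Fix s) q))" if p: "p \<in> points M" for p
    proof (cases "p \<in> Fix s0")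
      case True
      obtain d' \<delta> U where \<delta>: "\<delta> > 0" "openin (mtop M) U" "p \<in> U"
          and flat: "\<And>s q. s \<in> {0..1} \<Longrightarrow> dist s s0 < \<delta> \<Longrightarrow> q \<in> Fix s \<inter> U \<Longrightarrow> locally_flat_at M d' (Fix s) q"
        using fixed_neighbourhood[OF s0 True] by metis
      have "locally_flat_at M d' (Fix s0) p" using flat[OF s0] \<delta> True by simp
      then have "d' \<noteq> d" using s0' True by (auto simp: flat_times_def)
      have "\<not> locally_flat_at M d (Fix s) q" if "s \<in> {0..1}" "dist s s0 < \<delta>" "q \<in> Fix s \<inter> U" for s q
        using locally_flat_at_unique[OF flat[OF that]] that(3) \<open>d' \<noteq> d\<close> by blast
      then show ?thesis using \<delta> by blast
    next
      case False
      obtain \<delta> U where "\<delta> > 0" "openin (mtop M) U" "p \<in> U"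
          "\<And>s. s \<in> {0..1} \<Longrightarrow> dist s s0 < \<delta> \<Longrightarrow> Fix s \<inter> U = {}"
        using nonfixed_neighbourhood[OF s0 p False] by metis
      then show ?thesis by blast
    qed
    then obtain U \<delta> where U: "\<And>p. p \<in> points M \<Longrightarrow> openin (mtop M) (U p)" "\<And>p. p \<in> points M \<Longrightarrow> p \<in> U p"
        and \<delta>: "\<And>p. p \<in> points M \<Longrightarrow> \<delta> p > (0::real)"
        and not_flat: "\<And>p s q. p \<in> points M \<Longrightarrow> s \<in> {0..1} \<Longrightarrow> dist s s0 < \<delta> p \<Longrightarrow> q \<in> Fix s \<inter> U p \<Longrightarrow>
          \<not> locally_flat_at M d (Fix s) q"
      by metis
    have "compactin (mtop M) (points M)" using assms by (simp add: compact_space_def)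
    moreover have "\<forall>V \<in> U ` points M. openin (mtop M) V" using U(1) by blast
    moreover have "points M \<subseteq> \<Union>(U ` points M)" using U(2) by blast
    ultimately obtain \<F> where \<F>: "finite \<F>" "\<F> \<subseteq> U ` points M" "points M \<subseteq> \<Union>\<F>"
      unfolding compactin_def by meson
    then obtain I where I: "finite I" "I \<subseteq> points M" "\<F> = U ` I"
      using finite_subset_image by metis
    define e where "e = Min (insert 1 (\<delta> ` I))"
    have "e > 0" using I \<delta> by (auto simp: e_def)
    have e: "e \<le> \<delta> p" if "p \<in> I" for p using I(1) that by (auto simp: e_def)
    have "s \<in> {0..1} - flat_times d" if s: "s \<in> {0..1}" "dist s s0 < e" for s
    proof -
      have "\<not> locally_flat_at M d (Fix s) q" if q: "q \<in> Fix s" for q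
      proof -
        obtain p where p: "p \<in> I" "q \<in> U p" using \<F>(3) I(3) q Fix_subset by blast
        have "dist s s0 < \<delta> p" using e[OF p(1)] s(2) by simp
        then show ?thesis using not_flat[OF _ s(1), of p q] p q I(2) by blast
      qed
      then show ?thesis using s by (auto simp: flat_times_def)
    qed
    then show "\<exists>e>0. \<forall>s\<in>{0..1}. dist s s0 < e \<longrightarrow> s \<in> {0..1} - flat_times d"
      using \<open>e > 0\<close> by blast
  qed auto
  moreover have "flat_times d \<subseteq> {0..1}" by (auto simp: flat_times_def)
  ultimately show ?thesis by (simp add: closedin_def)
qed

lemma flat_times_trivial:
  assumes "compact_space (mtop M)"
  shows "flat_times d = {} \<or> flat_times d = {0..1}"
  using connected_clopen[of "{0..1::real}"] open_flat_times closed_flat_times[OF assms] by auto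

text \<open>The type is read off from local dimensions, since every component of the fixed point set is a
  submanifold of its local dimension.\<close>

lemma of_type_flat_times:
  assumes type: "of_type M \<psi> r" and fixed: "fixed_points M \<psi> = Fix s" and s: "s \<in> {0..1}"
  shows "s \<in> flat_times (2 * r)" "s \<in> flat_times d \<Longrightarrow> d \<le> 2 * r"
proof -
  have comps: "fixed_components M \<psi> = connected_components_of (subtopology (mtop M) (Fix s))"
    by (simp add: fixed_components_def fixed)
  have flat: "\<exists>d. locally_flat_at M d (Fix s) q" if q: "q \<in> Fix s" for q
  proof -
    obtain d \<delta> U where "\<delta> > 0" "q \<in> U" "\<And>s' q. s' \<in> {0..1} \<Longrightarrow> dist s' s < \<delta> \<Longrightarrow> q \<in> Fix s' \<inter> U \<Longrightarrow>
        locally_flat_at M d (Fix s') q"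
      using fixed_neighbourhood[OF s q] by metis
    with s q have "locally_flat_at M d (Fix s) q" by simp
    then show ?thesis by blast
  qed
  note comp = locally_flat_component[OF Fix_subset flat]
  obtain C where C: "C \<in> fixed_components M \<psi>" "submanifold M (2 * r) C"
    using type by (auto simp: of_type_def)
  have max: "d \<le> 2 * r" if "C \<in> fixed_components M \<psi>" "submanifold M d C" for C d
    using type that unfolding of_type_def by blast
  obtain p where p: "p \<in> C"
    using nonempty_connected_components_of C(1) unfolding comps by blast
  have "p \<in> Fix s"
    using connected_components_of_subset[OF C(1)[unfolded comps]] p by auto
  with flat obtain d' where d': "locally_flat_at M d' (Fix s) p" by blast
  have "2 * r = d'" using comp[OF _ C(1)[unfolded comps] p d'] C(2) by blast
  then show "s \<in> flat_times (2 * r)"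
    using d' \<open>p \<in> Fix s\<close> s by (auto simp: flat_times_def)
  assume "s \<in> flat_times d"
  then obtain q where q: "q \<in> Fix s" "locally_flat_at M d (Fix s) q" by (auto simp: flat_times_def)
  have "q \<in> topspace (subtopology (mtop M) (Fix s))" using q(1) Fix_subset by auto
  then have "q \<in> \<Union>(connected_components_of (subtopology (mtop M) (Fix s)))"
    by (simp only: Union_connected_components_of)
  then obtain C' where C': "C' \<in> connected_components_of (subtopology (mtop M) (Fix s))" "q \<in> C'"
    by (rule UnionE)
  have "submanifold M d C'" using comp[OF _ C' q(2), of d] by simp
  then show "d \<le> 2 * r" using max C'(1) unfolding comps by simp
qed

lemma type_invariant:
  assumes "compact_space (mtop M)"
    and "of_type M \<psi> r" "fixed_points M \<psi> = Fix 0"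
    and "of_type M \<psi>' r'" "fixed_points M \<psi>' = Fix 1"
  shows "r = r'"
proof -
  note t0 = of_type_flat_times[OF assms(2,3)] and t1 = of_type_flat_times[OF assms(4,5)]
  have "flat_times (2 * r) = {0..1}" "flat_times (2 * r') = {0..1}"
    using flat_times_trivial[OF assms(1)] t0(1) t1(1) by auto
  then have "2 * r \<le> 2 * r'" "2 * r' \<le> 2 * r" using t0(2)[of "2 * r'"] t1(2)[of "2 * r"] by auto
  then show ?thesis by simp
qed

end

section \<open>From Hamiltonian circle actions to homotopies of actions\<close>

lemma smooth_map_restrict:
  fixes M :: "('a, 'e::euclidean_space) manifold"
  assumes M: "smooth_manifold M" and f: "smooth_map M M f"
  shows "smooth_map M M (restrict f (points M))"
  unfolding smooth_map_def
proof (intro conjI ballI)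
  show "continuous_map (mtop M) (mtop M) (restrict f (points M))"
    using f continuous_map_eq unfolding smooth_map_def by (metis restrict_apply')
  fix c c' assume c: "c \<in> atlas M" "c' \<in> atlas M"
  have ch: "is_chart (mtop M) c" using M c by (simp add: smooth_manifold_def)
  have sub: "chart_dom c \<subseteq> points M" by (rule is_chart_dom_subset[OF ch])
  have "chart_dom c \<inter> restrict f (points M) -` chart_dom c' = chart_dom c \<inter> f -` chart_dom c'"
    using sub by auto
  moreover have "smooth_on (coord c ` (chart_dom c \<inter> f -` chart_dom c')) (coord_rep c c' (restrict f (points M)))"
  proof (rule smooth_on_cong)
    show "smooth_on (coord c ` (chart_dom c \<inter> f -` chart_dom c')) (coord_rep c c' f)"
      using f c by (simp add: smooth_map_def)
    fix x assume "x \<in> coord c ` (chart_dom c \<inter> f -` chart_dom c')"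
    then have "coord_inv c x \<in> points M" using coord_inv_coord[OF ch] sub by auto
    then show "coord_rep c c' f x = coord_rep c c' (restrict f (points M)) x"
      by (simp add: coord_rep_def)
  qed
  ultimately show "smooth_on (coord c ` (chart_dom c \<inter> restrict f (points M) -` chart_dom c'))
      (coord_rep c c' (restrict f (points M)))" by simp
qed

lemma Ham_properties:
  assumes M: "smooth_manifold M" and f: "f \<in> Ham M \<omega>"
  shows "f \<in> Bij (points M)" "smooth_map M M f"
proof -
  obtain H \<psi> where \<psi>: "f = restrict (\<psi> 1) (points M)" "hamiltonian_isotopy M \<omega> H \<psi>"
    using f unfolding Ham_def by blast
  then have d: "diffeomorphism M (\<psi> (1 :: real))" by (auto simp: hamiltonian_isotopy_def)
  show "smooth_map M M f"
    using smooth_map_restrict[OF M] d unfolding \<psi>(1) diffeomorphism_def by blast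
  show "f \<in> Bij (points M)"
    using d unfolding \<psi>(1) diffeomorphism_def Bij_def by (simp add: bij_betw_restrict_eq)
qed

lemma cis_turn_unit: "cis (2 * pi * t) \<in> sphere 0 1"
  by simp

lemma unit_complex_cis_turn:
  assumes "z \<in> sphere 0 1"
  obtains t where "z = cis (2 * pi * t)"
proof -
  have "z = cis (2 * pi * (Arg z / (2 * pi)))" using assms cis_Arg[of z] by (cases "z = 0") (auto simp: sgn_eq)
  then show thesis by (rule that)
qed

text \<open>The identity acts trivially because it acts by an idempotent bijection.\<close>

lemma action_homotopy_of_circle_actions:
  fixes \<Psi> :: "real \<Rightarrow> complex \<Rightarrow> 'a \<Rightarrow> 'a" and M :: "('a, 'e::euclidean_space) manifold"
  assumes M: "smooth_manifold M" and act: "\<forall>s \<in> {0..1}. circle_action M \<omega> (\<Psi> s)"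
    and cont: "continuous_map (prod_topology (top_of_set {0..1}) (mtop circle_manifold))
       (Ham_topology M \<omega>) (\<lambda>(s, z). \<Psi> s z)"
  shows "action_homotopy M (\<lambda>s t. \<Psi> s (cis (2 * pi * t)))"
proof
  have hom: "\<Psi> s \<in> hom circle_group (Ham_group M \<omega>)" if "s \<in> {0..1}" for s
    using act that by (simp add: hamiltonian_action_def)
  have Ham: "\<Psi> s z \<in> Ham M \<omega>" if "s \<in> {0..1}" "z \<in> sphere 0 1" for s z
    using hom[OF that(1)] that(2) by (auto simp: hom_def circle_group_def Ham_group_def)
  have Bij: "\<Psi> s z \<in> Bij (points M)" if "s \<in> {0..1}" "z \<in> sphere 0 1" for s z
    by (rule Ham_properties(1)[OF M Ham[OF that]])
  have mult: "\<Psi> s (z * w) p = \<Psi> s z (\<Psi> s w p)"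
    if s: "s \<in> {0..1}" and zw: "z \<in> sphere 0 1" "w \<in> sphere 0 1" and p: "p \<in> points M" for s z w p
  proof -
    have "\<Psi> s (z * w) = \<Psi> s z \<otimes>\<^bsub>Ham_group M \<omega>\<^esub> \<Psi> s w"
      using hom_mult[OF hom[OF s], of z w] zw by (simp add: circle_group_def)
    also have "\<dots> = compose (points M) (\<Psi> s z) (\<Psi> s w)"
      using Bij[OF s] zw by (simp add: Ham_group_def BijGroup_def)
    finally show ?thesis using p by (simp add: compose_def)
  qed
  show "smooth_manifold M" by (rule M)
  show "\<Psi> s (cis (2 * pi * t)) \<in> extensional (points M)" if "s \<in> {0..1}" for s t
    using Bij[OF that cis_turn_unit] by (rule Bij_imp_extensional)
  show "smooth_map M M (\<Psi> s (cis (2 * pi * t)))" if "s \<in> {0..1}" for s t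
    by (rule Ham_properties(2)[OF M Ham[OF that cis_turn_unit]])
  show "\<Psi> s (cis (2 * pi * (t + u))) p = \<Psi> s (cis (2 * pi * t)) (\<Psi> s (cis (2 * pi * u)) p)"
    if "s \<in> {0..1}" "p \<in> points M" for s p t u
    using mult[OF that(1) cis_turn_unit[of t] cis_turn_unit[of u] that(2)]
    by (simp add: cis_mult distrib_left)
  show "\<Psi> s (cis (2 * pi * 0)) p = p" if s: "s \<in> {0..1}" and p: "p \<in> points M" for s p
  proof -
    have B: "bij_betw (\<Psi> s 1) (points M) (points M)"
      using Bij[OF s, of 1] by (simp add: Bij_def)
    have "\<Psi> s 1 (\<Psi> s 1 p) = \<Psi> s 1 p" using mult[OF s _ _ p, of 1 1] by simp
    then have "\<Psi> s 1 p = p" using B p by (metis bij_betwE bij_betw_imp_inj_on inj_onD)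
    then show ?thesis by simp
  qed
  show "\<Psi> s (cis (2 * pi * (t + 1))) = \<Psi> s (cis (2 * pi * t))" for s t
    using cis_mult[of "2 * pi * t" "2 * pi"] by (simp add: distrib_left)
  show "continuous_map (prod_topology (top_of_set {0..1}) euclideanreal) (Cinf_topology M)
      (\<lambda>(s, t). \<Psi> s (cis (2 * pi * t)))"
  proof -
    have "continuous_map (prod_topology (top_of_set {0..1}) (mtop circle_manifold)) (Cinf_topology M)
        (\<lambda>(s, z). \<Psi> s z)"
      using cont continuous_map_into_fulltopology unfolding Ham_topology_def by blast
    moreover have "continuous_map (prod_topology (top_of_set {0..1::real}) euclideanreal)
        (prod_topology (top_of_set {0..1}) (mtop circle_manifold)) (\<lambda>(s, t). (s, cis (2 * pi * t)))"
    proof -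
      have turn: "continuous_map euclideanreal (top_of_set (sphere 0 1)) (\<lambda>t. cis (2 * pi * t))"
        by (auto simp: continuous_map_in_subtopology intro!: continuous_intros)
      have time: "continuous_map (top_of_set {0..1::real}) (top_of_set {0..1}) (\<lambda>s. s)" by simp
      from iffD2[OF continuous_map_prod_top, OF disjI2, OF conjI[OF time turn]]
      show ?thesis by (simp add: circle_manifold_def)
    qed
    ultimately show ?thesis
      using continuous_map_compose[of _ _ "\<lambda>(s, t). (s, cis (2 * pi * t))" _ "\<lambda>(s, z). \<Psi> s z"]
      by (simp add: o_def case_prod_unfold)
  qed
qed

theorem theorem2:
  fixes M :: "('a, 'e::euclidean_space) manifold" and \<omega> :: "('a, 'e) form2"
    and G :: "'g monoid" and \<G> :: "('g, 'h::euclidean_space) manifold"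
    and \<Phi> :: "'g \<Rightarrow> 'a \<Rightarrow> 'a"
    and X Y :: "('g, 'h) chart \<Rightarrow> 'h"
    and \<psi>\<^sub>X \<psi>\<^sub>Y :: "complex \<Rightarrow> 'a \<Rightarrow> 'a"
    and r s :: nat
  assumes "closed_symplectic_manifold M \<omega>"
    and "lie_group G \<G>"
    and "hamiltonian_action G \<G> M \<omega> \<Phi>"
    and "X \<in> lie_algebra G \<G>" and "Y \<in> lie_algebra G \<G>"
    and "defines_circle_action G \<G> M \<omega> \<Phi> X \<psi>\<^sub>X"
    and "defines_circle_action G \<G> M \<omega> \<Phi> Y \<psi>\<^sub>Y"
    and "of_type M \<psi>\<^sub>X r" and "of_type M \<psi>\<^sub>Y s" and "r \<noteq> s"
  shows "\<not> homotopic_circle_actions M \<omega> \<psi>\<^sub>X \<psi>\<^sub>Y"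
proof
  assume "homotopic_circle_actions M \<omega> \<psi>\<^sub>X \<psi>\<^sub>Y"
  then obtain \<Psi> :: "real \<Rightarrow> complex \<Rightarrow> 'a \<Rightarrow> 'a" where
      act: "\<forall>s \<in> {0..1}. circle_action M \<omega> (\<Psi> s)"
      and cont: "continuous_map (prod_topology (top_of_set {0..1}) (mtop circle_manifold))
        (Ham_topology M \<omega>) (\<lambda>(s, z). \<Psi> s z)"
      and ends: "\<forall>z \<in> carrier circle_group. \<Psi> 0 z = \<psi>\<^sub>X z \<and> \<Psi> 1 z = \<psi>\<^sub>Y z"
    unfolding homotopic_circle_actions_def by blast
  have M: "smooth_manifold M" "compact_space (mtop M)"
    using assms(1) by (auto simp: closed_symplectic_manifold_def)
  interpret action_homotopy M "\<lambda>s t. \<Psi> s (cis (2 * pi * t))"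
    by (rule action_homotopy_of_circle_actions[OF M(1) act cont])
  have carrier: "carrier circle_group = sphere 0 1" by (simp add: circle_group_def)
  have fixed: "fixed_points M \<psi> = Fix a"
    if "\<And>z. z \<in> sphere 0 1 \<Longrightarrow> \<psi> z = \<Psi> a z" for \<psi> a
    unfolding fixed_points_def Fix_def carrier
    using that unit_complex_cis_turn cis_turn_unit by (auto; metis)
  have "fixed_points M \<psi>\<^sub>X = Fix 0" "fixed_points M \<psi>\<^sub>Y = Fix 1"
    using ends carrier by (auto intro!: fixed)
  then have "r = s" using type_invariant[OF M(2) assms(8) _ assms(9)] by blast
  with assms(10) show False by contradiction
qed

end
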